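(* For every integer $n\ge 1$, $$\det(\mathcal{A}^n)=(-A_{n-1})^{\,n-3},$$ where $\mathcal{A}^n=(\mathcal{A}^n_{ij})_{1\le i,j\le n}$ is the matrix of doubly-refined enumerations of $n\times n$ alternating sign matrices with respect to the first and last rows, and $A_{n-1}$ is the number of alternating sign matrices of size $n-1$.
   Context: An alternating sign matrix (ASM) of size $n$ is an $n\times n$ matrix with entries in $\{-1,0,+1\}$ such that in each row and in each column the nonzero entries alternate in sign, and the sum of the entries of each row and each column equals $1$. Every ASM has exactly one $+1$ in its first row and exactly one $+1$ in its last row (and no $-1$ there). $A_n$ denotes the number of ASMs of size $n$; $A_n=\prod_{j=0}^{n-1}\frac{(3j+1)!}{(n+j)!}$, with $A_0=1$. For $1\le i,j\le n$, $\mathcal{A}^n_{ij}$ is the number of ASMs of size $n$ whose unique $+1$ in the first row is in column $i$ and whose unique $+1$ in the last row is in column $j$. *)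

theory Defs
  imports "Jordan_Normal_Form.Determinant"
begin

definition alternating_vec :: "int vec \<Rightarrow> bool" where
  "alternating_vec v \<longleftrightarrow>
     (\<forall>j k. j < k \<and> k < dim_vec v \<and> v $ j \<noteq> 0 \<and> v $ k \<noteq> 0 \<and> (\<forall>l. j < l \<and> l < k \<longrightarrow> v $ l = 0)
        \<longrightarrow> v $ k = - (v $ j))"

definition asm_line :: "int vec \<Rightarrow> bool" where
  "asm_line v \<longleftrightarrow> alternating_vec v \<and> (\<Sum>j<dim_vec v. v $ j) = 1"

definition ASM :: "nat \<Rightarrow> int mat set" where
  "ASM n = {M \<in> carrier_mat n n.
     (\<forall>i<n. \<forall>j<n. M $$ (i, j) \<in> {-1, 0, 1}) \<and>
     (\<forall>i<n. asm_line (row M i)) \<and>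
     (\<forall>j<n. asm_line (col M j))}"

(* ASM 0 consists of the empty matrix alone, so asm_count 0 = 1. *)
definition asm_count :: "nat \<Rightarrow> nat" where
  "asm_count n = card (ASM n)"

(* Matrix positions start at 0: the first row is row 0 and the last is row n - 1.  The columns
   i and j also start at 0.  The entry 1 in the first (last) row of an ASM is unique. *)
definition doubly_refined_count :: "nat \<Rightarrow> nat \<Rightarrow> nat \<Rightarrow> nat" where
  "doubly_refined_count n i j = card {M \<in> ASM n. M $$ (0, i) = 1 \<and> M $$ (n - 1, j) = 1}"

(* Rational entries, because the exponent n - 3 of the determinant formula is negative for n < 3. *)
definition doubly_refined_mat :: "nat \<Rightarrow> rat mat" where
  "doubly_refined_mat n = mat n n (\<lambda>(i, j). of_nat (doubly_refined_count n i j))"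

end

(*
  Weight the edges of a square-ice configuration of an alternating sign matrix at the combinatorial
  point (a cube root of unity \<omega>), where all weights with trivial spectral parameters are 1.  The
  Yang-Baxter equation makes the partition function symmetric in the column parameters, and its
  values at the two zeros of a corner weight then yield a three-term relation under x -> \<omega> x
  in the parameter x of the first row.  Hence (x - 1)^(2n-1) S_n(x), with S_n the refined
  enumeration, only involves the 2n exponents 0, 1, 3, 4, ..., 3n-3, 3n-2; a polynomial with so few
  terms cannot vanish to order 2n at 1.  Three consequences of this follow by linear algebra:
  the doubly refined generating function is the Bezoutian of (x - 1) S_n and
  (x^2 + x + 1) S_{n-1}; the S_n satisfy a three-term recurrence; and the roots of S_n are simple.
  Evaluating the doubly refined generating function at the roots of (x - 1) S_n diagonalises it,
  so the determinant becomes a resultant of S_n and S_{n-1}, which the recurrence computes.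
*)
theory Submission
  imports Defs "Jordan_Normal_Form.Char_Poly"
begin

section \<open>Vertex weights and the row recursion\<close>

text \<open>S_n is expanded in the products
  \<open>weight_a x 1 ^ i * weight_b x 1 ^ (n - 1 - i)\<close>, not in powers of x. At x = 1 both
  weights are 1, so S_n(1) = A_n. At \<omega> and \<omega>^2 one weight vanishes, the 1 of the first
  row is forced into a corner, and S_n equals A_{n-1} up to a unit. These evaluations supply the
  constants in A_n and A_{n-1}; the product formula for A_n never enters. The exponent 2n-1 counts
  the linear factors, one for each column and each row but the first, that make the values at the
  two zeros proportional with a constant ratio. The obstacle is that the zeros are numerous enough
  only for column parameters with distinct cubes, so the case of equal parameters is reached as a
  limit. The powers of 3 come from three places: the change from powers of x to the weights has a
  determinant constant of square -1/3, the recurrence has a factor -3, and the Bezoutian is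
  normalised by 3 A_{n-1}. Together they leave only the sign (-1)^(n-1).\<close>

definition \<omega> :: complex where "\<omega> = cis (2 * pi / 3)"

lemma omega_cubed: "\<omega> ^ 3 = 1"
  by (simp add: \<omega>_def Complex.DeMoivre)

lemma omega_neq_1: "\<omega> \<noteq> 1"
proof
  assume "\<omega> = 1"
  then have "Re \<omega> = 1" by simp
  then show False by (simp add: \<omega>_def cos_120)
qed

lemma omega_mult_self: "\<omega> * \<omega> = - 1 - \<omega>"
proof -
  have "(\<omega> - 1) * (\<omega> * \<omega> + \<omega> + 1) = 0"
    using omega_cubed by (simp add: algebra_simps power3_eq_cube)
  then have "\<omega> * \<omega> + \<omega> + 1 = 0" using omega_neq_1 by simp
  then show ?thesis by (simp add: algebra_simps eq_neg_iff_add_eq_0)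
qed

lemma omega_mult_self_left: "\<omega> * (\<omega> * z) = - z - \<omega> * z"
proof -
  have "\<omega> * (\<omega> * z) = (\<omega> * \<omega>) * z" by simp
  then show ?thesis unfolding omega_mult_self by (simp add: algebra_simps)
qed

lemma omega_sq: "\<omega>\<^sup>2 = - 1 - \<omega>"
  by (simp add: power2_eq_square omega_mult_self)

lemmas omega_simps = omega_mult_self omega_mult_self_left omega_sq

text \<open>These are \<open>(\<omega> u - \<omega>\<^sup>2 x) / (\<omega> - \<omega>\<^sup>2)\<close> and \<open>(\<omega> x - \<omega>\<^sup>2 u) / (\<omega> - \<omega>\<^sup>2)\<close>,
  with the denominator cleared by \<open>(\<omega> - \<omega>\<^sup>2)\<^sup>2 = - 3\<close>.\<close>

definition weight_a :: "complex \<Rightarrow> complex \<Rightarrow> complex" where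
  "weight_a x u = ((2 + \<omega>) * u + (1 - \<omega>) * x) / 3"

definition weight_b :: "complex \<Rightarrow> complex \<Rightarrow> complex" where
  "weight_b x u = ((2 + \<omega>) * x + (1 - \<omega>) * u) / 3"

text \<open>The edges around a matrix entry carry the partial sums of its row (\<open>h\<close> to the left, \<open>k\<close> to the
  right) and of its column (\<open>v\<close> above, \<open>v'\<close> below).  The entry itself is \<open>k - h = v' - v\<close>; only the
  product of the weights of the entries \<open>1\<close> and \<open>-1\<close> matters, so the former is normalised to 1, which
  keeps the degree in the parameter of the first row minimal.\<close>

definition vertex_weight :: "complex \<Rightarrow> complex \<Rightarrow> bool \<Rightarrow> bool \<Rightarrow> bool \<Rightarrow> bool \<Rightarrow> complex" where
  "vertex_weight x u h v k v' =
     (if h = k \<and> v = v' then if h = v then weight_a x u else weight_b x u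
      else if \<not> h \<and> \<not> v \<and> k \<and> v' then 1
      else if h \<and> v \<and> \<not> k \<and> \<not> v' then x * u else 0)"

text \<open>A transfer-matrix element: \<open>h\<close> and \<open>k\<close> are the outermost
  horizontal edges, \<open>vs\<close> and \<open>vs'\<close> the vertical edges above and below, and
  the inner horizontal edges are summed over. Since states are read by \<open>hd\<close> and
  \<open>tl\<close>, the value is meant only for lists of matching length.\<close>

primrec row_weight :: "complex \<Rightarrow> complex list \<Rightarrow> bool \<Rightarrow> bool list \<Rightarrow> bool list \<Rightarrow> bool \<Rightarrow> complex" where
  "row_weight x [] h vs vs' k = of_bool (h = k)"
| "row_weight x (u # ws) h vs vs' k =
     vertex_weight x u h (hd vs) True (hd vs') * row_weight x ws True (tl vs) (tl vs') k +
     vertex_weight x u h (hd vs) False (hd vs') * row_weight x ws False (tl vs) (tl vs') k"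

definition bool_lists :: "nat \<Rightarrow> bool list set" where
  "bool_lists n = {vs. length vs = n}"

text \<open>Here \<open>xs\<close> and \<open>ws\<close> are the spectral parameters of the rows and columns, and \<open>vs\<close> is the state of
  the vertical edges above the first row; all edges below the last row are \<open>True\<close>.\<close>

primrec partition_fn :: "complex list \<Rightarrow> complex list \<Rightarrow> bool list \<Rightarrow> complex" where
  "partition_fn [] ws vs = of_bool (\<forall>v\<in>set vs. v)"
| "partition_fn (x # xs) ws vs =
     (\<Sum>vs'\<in>bool_lists (length ws). row_weight x ws False vs vs' True * partition_fn xs ws vs')"

lemma finite_bool_lists [simp]: "finite (bool_lists n)"
  using finite_lists_length_eq[of "UNIV :: bool set" n] by (simp add: bool_lists_def)

lemma sum_bool_lists_append:
  "(\<Sum>vs\<in>bool_lists (m + k). f vs) = (\<Sum>p\<in>bool_lists m. \<Sum>q\<in>bool_lists k. f (p @ q))"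
proof -
  have "(\<Sum>p\<in>bool_lists m. \<Sum>q\<in>bool_lists k. f (p @ q)) = (\<Sum>(p, q)\<in>bool_lists m \<times> bool_lists k. f (p @ q))"
    by (rule sum.cartesian_product)
  also have "\<dots> = (\<Sum>vs\<in>bool_lists (m + k). f vs)"
    by (rule sum.reindex_bij_witness[where j = "\<lambda>(p, q). p @ q" and i = "\<lambda>vs. (take m vs, drop m vs)"])
       (auto simp: bool_lists_def)
  finally show ?thesis ..
qed

lemma sum_bool_lists_1: "(\<Sum>vs\<in>bool_lists (Suc 0). f vs) = f [True] + f [False]"
proof -
  have "bool_lists (Suc 0) = {[True], [False]}"
    by (auto simp: bool_lists_def length_Suc_conv)
  then show ?thesis by simp
qed

lemma sum_bool_lists_Suc:
  "(\<Sum>vs\<in>bool_lists (Suc n). f vs) = (\<Sum>q\<in>bool_lists n. f (True # q)) + (\<Sum>q\<in>bool_lists n. f (False # q))"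
  using sum_bool_lists_append[of f "Suc 0" n] by (simp add: sum_bool_lists_1)

lemma row_weight_append:
  assumes "length vA = length A" "length vA' = length A"
  shows "row_weight x (A @ B) h (vA @ vB) (vA' @ vB') k =
    row_weight x A h vA vA' True * row_weight x B True vB vB' k +
    row_weight x A h vA vA' False * row_weight x B False vB vB' k"
  using assms
proof (induction A arbitrary: h vA vA')
  case Nil
  then show ?case by simp
next
  case (Cons u A)
  then obtain p P q Q where "vA = p # P" "vA' = q # Q" "length P = length A" "length Q = length A"
    by (auto simp: length_Suc_conv)
  with Cons.IH show ?case by (simp add: algebra_simps)
qed

section \<open>Symmetry in the column parameters\<close>

text \<open>The R-matrix that intertwines two adjacent columns.  It fixes the states \<open>False, False\<close> and
  \<open>True, True\<close> up to the same scalar, so that it disappears at both ends of the columns.\<close>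

definition exchange_matrix :: "complex \<Rightarrow> complex \<Rightarrow> bool \<Rightarrow> bool \<Rightarrow> bool \<Rightarrow> bool \<Rightarrow> complex" where
  "exchange_matrix u v a b c d =
     (if a = b then if c = a \<and> d = a then \<omega> * u - \<omega>\<^sup>2 * v else 0
      else if a = d \<and> b = c then v - u
      else if a = c \<and> b = d then (\<omega> - \<omega>\<^sup>2) * (if a then v else u) else 0)"

text \<open>A check of 64 boundary states, each a polynomial identity modulo \<omega>^2 = -1 -
  \<omega>. The unequal entries \<open>v\<close> and \<open>u\<close> in
  \<open>exchange_matrix\<close> compensate for the unsymmetric weights 1 and \<open>x * u\<close>
  of the matrix entries 1 and -1.\<close>

lemma yang_baxter:
  "(\<Sum>c\<in>UNIV. \<Sum>d\<in>UNIV. \<Sum>m\<in>UNIV. exchange_matrix u v a b c d *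
      (vertex_weight x u h c m e * vertex_weight x v m d k f)) =
   (\<Sum>c\<in>UNIV. \<Sum>d\<in>UNIV. \<Sum>m\<in>UNIV. vertex_weight x v h a m c * vertex_weight x u m b k d *
      exchange_matrix u v c d e f)"
  by (cases h; cases k; cases a; cases b; cases e; cases f)
     (simp_all add: vertex_weight_def exchange_matrix_def UNIV_bool weight_a_def weight_b_def field_simps omega_simps)

lemma row_weight_exchange:
  assumes "length vA = length A" "length vA' = length A"
  shows "(\<Sum>c\<in>UNIV. \<Sum>d\<in>UNIV. exchange_matrix u v a b c d *
            row_weight x (A @ u # v # B) h (vA @ c # d # vB) (vA' @ e # f # vB') k) =
         (\<Sum>c\<in>UNIV. \<Sum>d\<in>UNIV. row_weight x (A @ v # u # B) h (vA @ a # b # vB) (vA' @ c # d # vB') k *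
            exchange_matrix u v c d e f)"
    (is "?L = ?R")
proof -
  define \<alpha> where "\<alpha> = (\<lambda>m. row_weight x A h vA vA' m)"
  define \<beta> where "\<beta> = (\<lambda>m. row_weight x B m vB vB' k)"
  define Y where "Y = (\<lambda>p q. \<Sum>c\<in>UNIV. \<Sum>d\<in>UNIV. \<Sum>m\<in>UNIV. exchange_matrix u v a b c d *
      (vertex_weight x u p c m e * vertex_weight x v m d q f))"
  define Y' where "Y' = (\<lambda>p q. \<Sum>c\<in>UNIV. \<Sum>d\<in>UNIV. \<Sum>m\<in>UNIV. vertex_weight x v p a m c *
      vertex_weight x u m b q d * exchange_matrix u v c d e f)"
  have "?L = (\<Sum>p\<in>UNIV. \<Sum>q\<in>UNIV. \<alpha> p * \<beta> q * Y p q)"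
    using assms by (simp add: row_weight_append UNIV_bool \<alpha>_def \<beta>_def Y_def algebra_simps)
  moreover have "?R = (\<Sum>p\<in>UNIV. \<Sum>q\<in>UNIV. \<alpha> p * \<beta> q * Y' p q)"
    using assms by (simp add: row_weight_append UNIV_bool \<alpha>_def \<beta>_def Y'_def algebra_simps)
  moreover have "Y = Y'"
    unfolding Y_def Y'_def by (intro ext yang_baxter)
  ultimately show ?thesis by simp
qed

lemma sum_bool_lists_middle:
  "(\<Sum>vs\<in>bool_lists (m + Suc (Suc k)). f vs) =
     (\<Sum>p\<in>bool_lists m. \<Sum>q\<in>bool_lists k. \<Sum>c\<in>UNIV. \<Sum>d\<in>UNIV. f (p @ c # d # q))"
  unfolding sum_bool_lists_append[of f m "Suc (Suc k)"]
  by (simp add: sum_bool_lists_Suc UNIV_bool sum.distrib add_ac)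

text \<open>The R-matrix placed above the top row is pushed down one row at a time and leaves below
  the last row, where both edges are \<open>True\<close> and it is a scalar. Arbitrary states above
  the top row are needed for the induction.\<close>

lemma partition_fn_exchange_aux:
  assumes "length vA = length A" "length vB = length B"
  shows "(\<Sum>c\<in>UNIV. \<Sum>d\<in>UNIV. exchange_matrix u v a b c d *
            partition_fn xs (A @ u # v # B) (vA @ c # d # vB)) =
         (\<omega> * u - \<omega>\<^sup>2 * v) * partition_fn xs (A @ v # u # B) (vA @ a # b # vB)"
  using assms
proof (induction xs arbitrary: vA vB a b)
  case Nil
  show ?case
    by (cases a; cases b) (simp_all add: UNIV_bool exchange_matrix_def)
next
  case (Cons x xs)
  let ?A = "bool_lists (length A)" and ?B = "bool_lists (length B)"
  have len: "length (A @ u # v # B) = length A + Suc (Suc (length B))" for u v by simp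
  have "(\<Sum>c\<in>UNIV. \<Sum>d\<in>UNIV. exchange_matrix u v a b c d * partition_fn (x # xs) (A @ u # v # B) (vA @ c # d # vB))
     = (\<Sum>c\<in>UNIV. \<Sum>d\<in>UNIV. \<Sum>p\<in>?A. \<Sum>q\<in>?B. \<Sum>e\<in>UNIV. \<Sum>f\<in>UNIV. exchange_matrix u v a b c d *
          (row_weight x (A @ u # v # B) False (vA @ c # d # vB) (p @ e # f # q) True *
           partition_fn xs (A @ u # v # B) (p @ e # f # q)))"
    by (simp only: partition_fn.simps len sum_bool_lists_middle sum_distrib_left)
  also have "\<dots> = (\<Sum>p\<in>?A. \<Sum>q\<in>?B. \<Sum>e\<in>UNIV. \<Sum>f\<in>UNIV. (\<Sum>c\<in>UNIV. \<Sum>d\<in>UNIV. exchange_matrix u v a b c d *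
          row_weight x (A @ u # v # B) False (vA @ c # d # vB) (p @ e # f # q) True) *
           partition_fn xs (A @ u # v # B) (p @ e # f # q))"
    by (simp add: UNIV_bool sum.distrib algebra_simps)
  also have "\<dots> = (\<Sum>p\<in>?A. \<Sum>q\<in>?B. \<Sum>e\<in>UNIV. \<Sum>f\<in>UNIV. (\<Sum>c\<in>UNIV. \<Sum>d\<in>UNIV.
          row_weight x (A @ v # u # B) False (vA @ a # b # vB) (p @ c # d # q) True *
          exchange_matrix u v c d e f) *
           partition_fn xs (A @ u # v # B) (p @ e # f # q))"
    using Cons.prems by (intro sum.cong refl arg_cong2[where f = "(*)"] row_weight_exchange) (auto simp: bool_lists_def)
  also have "\<dots> = (\<Sum>p\<in>?A. \<Sum>q\<in>?B. \<Sum>c\<in>UNIV. \<Sum>d\<in>UNIV.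
          row_weight x (A @ v # u # B) False (vA @ a # b # vB) (p @ c # d # q) True *
          (\<Sum>e\<in>UNIV. \<Sum>f\<in>UNIV. exchange_matrix u v c d e f *
           partition_fn xs (A @ u # v # B) (p @ e # f # q)))"
    by (simp add: UNIV_bool sum.distrib algebra_simps)
  also have "\<dots> = (\<Sum>p\<in>?A. \<Sum>q\<in>?B. \<Sum>c\<in>UNIV. \<Sum>d\<in>UNIV.
          row_weight x (A @ v # u # B) False (vA @ a # b # vB) (p @ c # d # q) True *
          ((\<omega> * u - \<omega>\<^sup>2 * v) * partition_fn xs (A @ v # u # B) (p @ c # d # q)))"
    by (intro sum.cong refl arg_cong2[where f = "(*)"] Cons.IH) (auto simp: bool_lists_def)
  also have "\<dots> = (\<omega> * u - \<omega>\<^sup>2 * v) * partition_fn (x # xs) (A @ v # u # B) (vA @ a # b # vB)"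
    by (simp only: partition_fn.simps len sum_bool_lists_middle sum_distrib_left mult_ac)
  finally show ?case .
qed

text \<open>Under top edges \<open>False\<close> the R-matrix is the same scalar \<omega> u -
  \<omega>^2 v as at the bottom; distinct cubes make it nonzero, so it cancels.\<close>

lemma partition_fn_exchange:
  assumes "u ^ 3 \<noteq> v ^ 3"
  shows "partition_fn xs (A @ u # v # B) (replicate (length A + Suc (Suc (length B))) False) =
         partition_fn xs (A @ v # u # B) (replicate (length A + Suc (Suc (length B))) False)"
proof -
  have rep: "replicate (length A + Suc (Suc (length B))) False =
        replicate (length A) False @ False # False # replicate (length B) False"
    by (simp only: replicate_add replicate.simps)
  have "\<omega> * u \<noteq> \<omega>\<^sup>2 * v"
  proof
    assume "\<omega> * u = \<omega>\<^sup>2 * v"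
    then have "(\<omega> * u) ^ 3 = (\<omega>\<^sup>2 * v) ^ 3" by simp
    then have "\<omega> ^ 3 * u ^ 3 = (\<omega> ^ 3)\<^sup>2 * v ^ 3"
      by (simp add: power_mult_distrib flip: power_mult)
    then show False using assms by (simp add: omega_cubed)
  qed
  then show ?thesis
    using partition_fn_exchange_aux[of "replicate (length A) False" A "replicate (length B) False" B u v False False xs]
    unfolding rep by (simp add: UNIV_bool exchange_matrix_def)
qed

lemma partition_fn_move_to_front:
  assumes "\<forall>a\<in>set A. a ^ 3 \<noteq> u ^ 3"
  shows "partition_fn xs (A @ u # B) (replicate (length A + Suc (length B)) False) =
         partition_fn xs (u # A @ B) (replicate (length A + Suc (length B)) False)"
  using assms
proof (induction A arbitrary: B rule: rev_induct)
  case Nil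
  then show ?case by simp
next
  case (snoc a A)
  have "partition_fn xs (A @ a # u # B) (replicate (length A + Suc (Suc (length B))) False) =
        partition_fn xs (A @ u # a # B) (replicate (length A + Suc (Suc (length B))) False)"
    by (rule partition_fn_exchange) (use snoc.prems in auto)
  also have "\<dots> = partition_fn xs (u # A @ a # B) (replicate (length A + Suc (Suc (length B))) False)"
    using snoc.IH[of "a # B"] snoc.prems by simp
  finally show ?case by simp
qed

lemma partition_fn_move_to_back:
  assumes "\<forall>a\<in>set B. a ^ 3 \<noteq> u ^ 3"
  shows "partition_fn xs (A @ u # B) (replicate (length A + Suc (length B)) False) =
         partition_fn xs (A @ B @ [u]) (replicate (length A + Suc (length B)) False)"
  using assms
proof (induction B arbitrary: A)
  case Nil
  then show ?case by simp
next
  case (Cons b B)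
  have "partition_fn xs (A @ u # b # B) (replicate (length A + Suc (Suc (length B))) False) =
        partition_fn xs (A @ b # u # B) (replicate (length A + Suc (Suc (length B))) False)"
    by (rule partition_fn_exchange) (use Cons.prems in \<open>metis list.set_intros(1)\<close>)
  also have "\<dots> = partition_fn xs (A @ b # B @ [u]) (replicate (length A + Suc (Suc (length B))) False)"
    using Cons.IH[of "A @ [b]"] Cons.prems by simp
  finally show ?case by simp
qed

section \<open>Frozen rows and columns\<close>

lemma row_weight_True_column:
  "row_weight x (u # B) False (True # vs) (v' # vs') k =
     (if v' then weight_b x u * row_weight x B False vs vs' k else 0)"
  by (simp add: vertex_weight_def)

text \<open>At the left border the incoming edge is \<open>False\<close>; against a vertical
  \<open>True\<close> the only vertex is the straight one with \<open>weight_b\<close>. So the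
  column stays \<open>True\<close> and decouples.\<close>

lemma partition_fn_True_column:
  "partition_fn zs (u # B) (True # vs) = (\<Prod>z\<leftarrow>zs. weight_b z u) * partition_fn zs B vs"
  by (induction zs arbitrary: vs)
     (simp_all add: sum_bool_lists_Suc row_weight_True_column sum_distrib_left mult_ac del: row_weight.simps)

lemma row_weight_last_column:
  assumes "length vs = length B" "length vs' = length B"
  shows "row_weight x (B @ [u]) h (vs @ [True]) (vs' @ [v']) True =
     (if v' then weight_a x u * row_weight x B h vs vs' True else 0)"
  using row_weight_append[OF assms, of x "[u]" h "[True]" "[v']" True]
  by (simp add: vertex_weight_def)

lemma sum_bool_lists_snoc:
  "(\<Sum>vs\<in>bool_lists (Suc n). f vs) = (\<Sum>q\<in>bool_lists n. f (q @ [True]) + f (q @ [False]))"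
  using sum_bool_lists_append[of f n "Suc 0"] by (simp add: sum_bool_lists_1)

text \<open>At the right border the outgoing edge is \<open>True\<close>; with a vertical
  \<open>True\<close> above, this forces \<open>True\<close> from the left as well, hence the
  straight vertex with \<open>weight_a\<close>.\<close>

lemma partition_fn_last_column:
  assumes "length vs = length B"
  shows "partition_fn zs (B @ [u]) (vs @ [True]) = (\<Prod>z\<leftarrow>zs. weight_a z u) * partition_fn zs B vs"
  using assms
proof (induction zs arbitrary: vs)
  case Nil
  then show ?case by simp
next
  case (Cons z zs)
  have "partition_fn (z # zs) (B @ [u]) (vs @ [True]) =
     (\<Sum>q\<in>bool_lists (length B). weight_a z u * row_weight z B False vs q True * ((\<Prod>z\<leftarrow>zs. weight_a z u) * partition_fn zs B q))"
    using Cons by (simp add: sum_bool_lists_snoc) 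
      (intro sum.cong refl, auto simp: bool_lists_def row_weight_last_column)
  then show ?case by (simp add: sum_distrib_left mult_ac)
qed

text \<open>An entry -1 needs a vertical \<open>True\<close> above it, so under top edges
  \<open>False\<close> nothing but straight vertices can follow the 1 of the row.\<close>

lemma row_weight_after_one:
  assumes "length vs' = length B"
  shows "row_weight x B True (replicate (length B) False) vs' True =
     (if vs' = replicate (length B) False then (\<Prod>w\<leftarrow>B. weight_b x w) else 0)"
  using assms
proof (induction B arbitrary: vs')
  case Nil
  then show ?case by simp
next
  case (Cons u B)
  then obtain v V where "vs' = v # V" "length V = length B" by (auto simp: length_Suc_conv)
  with Cons.IH[of V] show ?case by (auto simp: vertex_weight_def)
qed

lemma row_weight_before_one:
  assumes "length vs' = length B"
  shows "row_weight x B False (replicate (length B) False) vs' False =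
     (if vs' = replicate (length B) False then (\<Prod>w\<leftarrow>B. weight_a x w) else 0)"
  using assms
proof (induction B arbitrary: vs')
  case Nil
  then show ?case by simp
next
  case (Cons u B)
  then obtain v V where vs': "vs' = v # V" "length V = length B" by (auto simp: length_Suc_conv)
  have "row_weight x B True (replicate (length B) False) V False = 0" for V
    by (induction B arbitrary: V) (auto simp: vertex_weight_def)
  with Cons.IH[of V] show ?case by (auto simp: vertex_weight_def vs')
qed

lemma sum_bool_lists_delta:
  "length p = n \<Longrightarrow> (\<Sum>q\<in>bool_lists n. if q = p then f q else 0) = f p"
  by (simp add: sum.delta bool_lists_def[of n, symmetric]) (simp add: bool_lists_def)

text \<open>The top left vertex has \<open>False\<close> on its left and above, so it is either
  straight with \<open>weight_a\<close> or carries a 1. When \<open>weight_a\<close> vanishes the 1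
  is forced, and the rest of the first row and the first column is frozen. The mirror image at the
  top right corner uses a zero of \<open>weight_b\<close>.\<close>

lemma partition_fn_freeze_first:
  assumes "weight_a x u = 0"
  shows "partition_fn (x # zs) (u # B) (replicate (Suc (length B)) False) =
     (\<Prod>w\<leftarrow>B. weight_b x w) * (\<Prod>z\<leftarrow>zs. weight_b z u) * partition_fn zs B (replicate (length B) False)"
proof -
  have "partition_fn (x # zs) (u # B) (replicate (Suc (length B)) False) =
     (\<Sum>q\<in>bool_lists (length B). row_weight x B True (replicate (length B) False) q True * partition_fn zs (u # B) (True # q))"
    using assms by (simp add: sum_bool_lists_Suc vertex_weight_def)
  also have "\<dots> = (\<Sum>q\<in>bool_lists (length B). if q = replicate (length B) False
       then (\<Prod>w\<leftarrow>B. weight_b x w) * partition_fn zs (u # B) (True # q) else 0)"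
    by (intro sum.cong refl) (auto simp: row_weight_after_one bool_lists_def)
  also have "\<dots> = (\<Prod>w\<leftarrow>B. weight_b x w) * partition_fn zs (u # B) (True # replicate (length B) False)"
    by (rule sum_bool_lists_delta) simp
  finally show ?thesis by (simp add: partition_fn_True_column mult_ac)
qed

lemma partition_fn_freeze_last:
  assumes "weight_b x u = 0"
  shows "partition_fn (x # zs) (B @ [u]) (replicate (Suc (length B)) False) =
     (\<Prod>w\<leftarrow>B. weight_a x w) * (\<Prod>z\<leftarrow>zs. weight_a z u) * partition_fn zs B (replicate (length B) False)"
proof -
  let ?r = "replicate (length B) False"
  have rep: "replicate (Suc (length B)) False = ?r @ [False]"
    by (simp add: replicate_append_same)
  have "partition_fn (x # zs) (B @ [u]) (?r @ [False]) =
     (\<Sum>q\<in>bool_lists (length B). row_weight x B False ?r q False * partition_fn zs (B @ [u]) (q @ [True]))"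
    using assms by (simp add: sum_bool_lists_snoc)
      (intro sum.cong refl, auto simp: bool_lists_def row_weight_append vertex_weight_def)
  also have "\<dots> = (\<Sum>q\<in>bool_lists (length B). if q = ?r
       then (\<Prod>w\<leftarrow>B. weight_a x w) * partition_fn zs (B @ [u]) (q @ [True]) else 0)"
    by (intro sum.cong refl) (auto simp: row_weight_before_one bool_lists_def)
  also have "\<dots> = (\<Prod>w\<leftarrow>B. weight_a x w) * partition_fn zs (B @ [u]) (?r @ [True])"
    by (rule sum_bool_lists_delta) simp
  finally show ?thesis
    unfolding rep by (simp only: partition_fn_last_column length_replicate mult_ac)
qed

section \<open>The spectral parameter of the first row\<close>

text \<open>A strict degree bound, in which d = 0 singles out the zero function; d is then exactly
  the number of zeros that forces the function to vanish.\<close>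

definition polynomial_below :: "nat \<Rightarrow> (complex \<Rightarrow> complex) \<Rightarrow> bool" where
  "polynomial_below d f \<longleftrightarrow> (\<exists>p. (\<forall>x. f x = poly p x) \<and> (\<forall>k\<ge>d. coeff p k = 0))"

lemma polynomial_below_0: "polynomial_below d (\<lambda>x. 0)"
  unfolding polynomial_below_def by (rule exI[of _ 0]) simp

lemma polynomial_below_const: "d > 0 \<Longrightarrow> polynomial_below d (\<lambda>x. c)"
  unfolding polynomial_below_def by (rule exI[of _ "[:c:]"]) (auto simp: coeff_pCons split: nat.splits)

lemma polynomial_below_add: "polynomial_below d f \<Longrightarrow> polynomial_below d g \<Longrightarrow> polynomial_below d (\<lambda>x. f x + g x)"
  unfolding polynomial_below_def
proof (elim exE conjE)
  fix p q assume "\<forall>x. f x = poly p x" "\<forall>x. g x = poly q x" "\<forall>k\<ge>d. coeff p k = 0" "\<forall>k\<ge>d. coeff q k = 0"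
  then show "\<exists>p. (\<forall>x. f x + g x = poly p x) \<and> (\<forall>k\<ge>d. coeff p k = 0)"
    by (intro exI[of _ "p + q"]) simp
qed

lemma polynomial_below_cmult: "polynomial_below d f \<Longrightarrow> polynomial_below d (\<lambda>x. c * f x)"
  unfolding polynomial_below_def
proof (elim exE conjE)
  fix p assume "\<forall>x. f x = poly p x" "\<forall>k\<ge>d. coeff p k = 0"
  then show "\<exists>p. (\<forall>x. c * f x = poly p x) \<and> (\<forall>k\<ge>d. coeff p k = 0)"
    by (intro exI[of _ "smult c p"]) simp
qed

lemma polynomial_below_linear_mult: "polynomial_below d f \<Longrightarrow> polynomial_below (Suc d) (\<lambda>x. (b * x + c) * f x)"
  unfolding polynomial_below_def
proof (elim exE conjE)
  fix p assume "\<forall>x. f x = poly p x" "\<forall>k\<ge>d. coeff p k = 0"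
  then show "\<exists>p. (\<forall>x. (b * x + c) * f x = poly p x) \<and> (\<forall>k\<ge>Suc d. coeff p k = 0)"
    by (intro exI[of _ "[:c, b:] * p"])
       (auto simp: algebra_simps coeff_pCons split: nat.splits)
qed

lemma polynomial_below_sum: "(\<And>i. i \<in> I \<Longrightarrow> polynomial_below d (f i)) \<Longrightarrow> polynomial_below d (\<lambda>x. \<Sum>i\<in>I. f i x)"
  by (induction I rule: infinite_finite_induct) (auto intro: polynomial_below_0 polynomial_below_add)

lemma polynomial_below_dilate: "polynomial_below d f \<Longrightarrow> polynomial_below d (\<lambda>x. f (c * x))"
  unfolding polynomial_below_def
proof (elim exE conjE)
  fix p assume "\<forall>x. f x = poly p x" "\<forall>k\<ge>d. coeff p k = 0"
  then show "\<exists>p. (\<forall>x. f (c * x) = poly p x) \<and> (\<forall>k\<ge>d. coeff p k = 0)"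
    by (intro exI[of _ "pcompose p [:0, c:]"])
       (auto simp: poly_pcompose coeff_pcompose_linear mult.commute)
qed

lemma polynomial_below_prod_list:
  "polynomial_below d f \<Longrightarrow> polynomial_below (d + length zs) (\<lambda>x. f x * (\<Prod>z\<leftarrow>zs. x - z))"
proof (induction zs)
  case Nil
  then show ?case by simp
next
  case (Cons z zs)
  then have "polynomial_below (Suc (d + length zs)) (\<lambda>x. (1 * x + (- z)) * (f x * (\<Prod>z\<leftarrow>zs. x - z)))"
    by (intro polynomial_below_linear_mult) auto
  then show ?case by (simp add: algebra_simps)
qed

lemma polynomial_below_many_zeros:
  assumes "polynomial_below d f" "finite S" "card S \<ge> d" "\<And>x. x \<in> S \<Longrightarrow> f x = 0"
  shows "f x = 0"
proof (cases "d = 0")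
  case True
  then show ?thesis using assms(1) by (auto simp: polynomial_below_def poly_altdef)
next
  case False
  obtain p where p: "\<And>x. f x = poly p x" "\<And>k. k \<ge> d \<Longrightarrow> coeff p k = 0"
    using assms(1) unfolding polynomial_below_def by blast
  have "p = 0"
  proof (rule ccontr)
    assume "p \<noteq> 0"
    then have "coeff p (degree p) \<noteq> 0" by simp
    then have "degree p < d" using p(2) not_less by blast
    moreover have "card S \<le> card {x. poly p x = 0}"
      using assms(4) p(1) \<open>p \<noteq> 0\<close> by (intro card_mono poly_roots_finite) auto
    moreover have "card {x. poly p x = 0} \<le> degree p"
      using \<open>p \<noteq> 0\<close> by (rule poly_roots_degree)
    ultimately show False using assms(3) by linarith
  qed
  then show ?thesis using p by simp
qed

lemma polynomial_below_weight_a_mult: "polynomial_below d f \<Longrightarrow> polynomial_below (Suc d) (\<lambda>x. weight_a x u * f x)"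
  using polynomial_below_linear_mult[of d f "(1 - \<omega>) / 3" "(2 + \<omega>) * u / 3"]
  by (simp add: weight_a_def add_divide_distrib add.commute)

lemma polynomial_below_weight_b_mult: "polynomial_below d f \<Longrightarrow> polynomial_below (Suc d) (\<lambda>x. weight_b x u * f x)"
  using polynomial_below_linear_mult[of d f "(2 + \<omega>) / 3" "(1 - \<omega>) * u / 3"]
  by (simp add: weight_b_def add_divide_distrib flip: times_divide_eq_left)

text \<open>The vertex that carries the 1 has constant weight, all others are linear in x. A row
  entered with \<open>h\<close> already \<open>True\<close> has no such vertex left, hence the extra
  1 in the bound.\<close>

lemma polynomial_below_row_weight:
  "polynomial_below (length ws + of_bool h) (\<lambda>x. row_weight x ws h (replicate (length ws) False) vs' True)"
proof (induction ws arbitrary: h vs')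
  case Nil
  then show ?case by (cases h) (auto intro: polynomial_below_0 polynomial_below_const)
next
  case (Cons u ws)
  show ?case
  proof (cases h)
    case True
    have "polynomial_below (Suc (Suc (length ws))) (\<lambda>x. weight_b x u *
        row_weight x ws True (replicate (length ws) False) (tl vs') True)"
      using Cons.IH[of True "tl vs'"] by (intro polynomial_below_weight_b_mult) simp
    then show ?thesis using True
      by (cases "hd vs'") (auto simp: vertex_weight_def intro: polynomial_below_0)
  next
    case False
    have "polynomial_below (Suc (length ws)) (\<lambda>x. weight_a x u *
        row_weight x ws False (replicate (length ws) False) (tl vs') True)"
      using Cons.IH[of False "tl vs'"] by (intro polynomial_below_weight_a_mult) simp
    moreover have "polynomial_below (Suc (length ws)) (\<lambda>x. row_weight x ws True (replicate (length ws) False) (tl vs') True)"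
      using Cons.IH[of True "tl vs'"] by simp
    ultimately show ?thesis using False
      by (cases "hd vs'") (auto simp: vertex_weight_def)
  qed
qed

lemma polynomial_below_partition_fn:
  "polynomial_below (length ws) (\<lambda>x. partition_fn (x # zs) ws (replicate (length ws) False))"
proof -
  have "polynomial_below (length ws) (\<lambda>x. \<Sum>vs'\<in>bool_lists (length ws). partition_fn zs ws vs' *
      row_weight x ws False (replicate (length ws) False) vs' True)"
    using polynomial_below_row_weight[of ws False] by (intro polynomial_below_sum polynomial_below_cmult) simp
  then show ?thesis by (simp add: mult.commute)
qed

text \<open>For a column parameter w, the weight \<open>weight_b\<close> at x = \<omega>^2 w is a
  multiple of \<omega> w - c for each other column c, and \<open>weight_a\<close> at x = \<omega> w
  is a multiple of \<omega>^2 w - c. The factors x - c supply the missing partner at each point; the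
  factors x - z do the same for the rows.\<close>

definition staircase_fn :: "complex list \<Rightarrow> complex list \<Rightarrow> complex \<Rightarrow> complex" where
  "staircase_fn zs ws x = partition_fn (x # zs) ws (replicate (length ws) False) *
     (\<Prod>z\<leftarrow>zs. x - z) * (\<Prod>w\<leftarrow>ws. x - w)"

lemma polynomial_below_staircase_fn: "polynomial_below (length ws + length zs + length ws) (staircase_fn zs ws)"
  unfolding staircase_fn_def by (intro polynomial_below_prod_list polynomial_below_partition_fn)

text \<open>Each remaining column contributes -\<omega> and each remaining row -\<omega>^2, with
  product 1; this is why their numbers have to agree.\<close>

lemma prod_list_rotate_ratio:
  assumes "length C = length zs"
    and "\<And>c. f c = - \<omega> * f' c" and "\<And>z. g z = - (\<omega>\<^sup>2) * g' z"
  shows "(\<Prod>c\<leftarrow>C. f c) * (\<Prod>z\<leftarrow>zs. g z) = (\<Prod>c\<leftarrow>C. f' c) * (\<Prod>z\<leftarrow>zs. g' z)"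
  using assms(1)
proof (induction C zs rule: list_induct2)
  case (Cons c C z zs)
  have "f c * g z = \<omega> ^ 3 * f' c * g' z"
    unfolding assms(2)[of c] assms(3)[of z] by (simp add: power2_eq_square power3_eq_cube)
  then have "f c * g z = f' c * g' z" by (simp add: omega_cubed)
  moreover have "(\<Prod>c\<leftarrow>c # C. f c) * (\<Prod>z\<leftarrow>z # zs. g z) =
      (f c * g z) * ((\<Prod>c\<leftarrow>C. f c) * (\<Prod>z\<leftarrow>zs. g z))" by (simp add: mult_ac)
  ultimately show ?case by (simp add: Cons.IH mult_ac)
qed simp

lemma prod_list_map_mult:
  fixes f g :: "'a \<Rightarrow> 'b::comm_monoid_mult"
  shows "(\<Prod>x\<leftarrow>xs. f x * g x) = (\<Prod>x\<leftarrow>xs. f x) * (\<Prod>x\<leftarrow>xs. g x)"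
  by (induction xs) (simp_all add: mult_ac)

lemma staircase_fn_at_column:
  assumes len: "length ws = Suc (length zs)" and "w \<in> set ws"
    and dist: "distinct (map (\<lambda>w. w ^ 3) ws)"
  shows "staircase_fn zs ws (\<omega>\<^sup>2 * w) = - (\<omega>\<^sup>2) * staircase_fn zs ws (\<omega> * w)"
proof -
  obtain A B where ws: "ws = A @ w # B" using \<open>w \<in> set ws\<close> by (meson split_list)
  have dA: "\<forall>a\<in>set A. a ^ 3 \<noteq> w ^ 3" and dB: "\<forall>a\<in>set B. a ^ 3 \<noteq> w ^ 3"
    using dist unfolding ws by (auto simp: image_iff)
  have rep: "replicate (length ws) False = replicate (length A + Suc (length B)) False"
    by (simp add: ws)
  let ?C = "A @ B"
  \<comment> \<open>Column symmetry lets w be moved to the front for one value and to the back for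
    the other, so both frozen configurations leave this same smaller partition function.\<close>
  define Z' where "Z' = partition_fn zs ?C (replicate (length ?C) False)"
  have lenC: "length ?C = length zs" using len by (simp add: ws)
  have "weight_a (\<omega>\<^sup>2 * w) w = 0"
    by (simp add: weight_a_def omega_simps algebra_simps)
  then have 1: "partition_fn (\<omega>\<^sup>2 * w # zs) ws (replicate (length ws) False) =
     (\<Prod>c\<leftarrow>?C. weight_b (\<omega>\<^sup>2 * w) c) * (\<Prod>z\<leftarrow>zs. weight_b z w) * Z'"
    using partition_fn_freeze_first[of "\<omega>\<^sup>2 * w" w zs ?C]
    unfolding rep unfolding ws partition_fn_move_to_front[OF dA] Z'_def by simp
  have "weight_b (\<omega> * w) w = 0"
    by (simp add: weight_b_def omega_simps algebra_simps)
  then have 2: "partition_fn (\<omega> * w # zs) ws (replicate (length ws) False) =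
     (\<Prod>c\<leftarrow>?C. weight_a (\<omega> * w) c) * (\<Prod>z\<leftarrow>zs. weight_a z w) * Z'"
    using partition_fn_freeze_last[of "\<omega> * w" w zs ?C]
    unfolding rep unfolding ws partition_fn_move_to_back[OF dB] Z'_def by simp
  have "(\<Prod>c\<leftarrow>?C. weight_b (\<omega>\<^sup>2 * w) c * (\<omega>\<^sup>2 * w - c)) * (\<Prod>z\<leftarrow>zs. weight_b z w * (\<omega>\<^sup>2 * w - z)) =
     (\<Prod>c\<leftarrow>?C. weight_a (\<omega> * w) c * (\<omega> * w - c)) * (\<Prod>z\<leftarrow>zs. weight_a z w * (\<omega> * w - z))"
    by (rule prod_list_rotate_ratio[OF lenC])
       (simp_all add: weight_a_def weight_b_def field_simps omega_simps)
  then have ratio: "(\<Prod>c\<leftarrow>?C. weight_b (\<omega>\<^sup>2 * w) c) * (\<Prod>c\<leftarrow>?C. \<omega>\<^sup>2 * w - c) *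
       ((\<Prod>z\<leftarrow>zs. weight_b z w) * (\<Prod>z\<leftarrow>zs. \<omega>\<^sup>2 * w - z)) =
     (\<Prod>c\<leftarrow>?C. weight_a (\<omega> * w) c) * (\<Prod>c\<leftarrow>?C. \<omega> * w - c) *
       ((\<Prod>z\<leftarrow>zs. weight_a z w) * (\<Prod>z\<leftarrow>zs. \<omega> * w - z))"
    by (simp only: prod_list_map_mult)
  have "staircase_fn zs ws (\<omega>\<^sup>2 * w) = (\<omega>\<^sup>2 * w - w) * Z' *
      ((\<Prod>c\<leftarrow>?C. weight_b (\<omega>\<^sup>2 * w) c) * (\<Prod>c\<leftarrow>?C. \<omega>\<^sup>2 * w - c) *
       ((\<Prod>z\<leftarrow>zs. weight_b z w) * (\<Prod>z\<leftarrow>zs. \<omega>\<^sup>2 * w - z)))"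
    unfolding staircase_fn_def 1 by (simp add: ws)
  also have "\<dots> = (\<omega>\<^sup>2 * w - w) * Z' * ((\<Prod>c\<leftarrow>?C. weight_a (\<omega> * w) c) * (\<Prod>c\<leftarrow>?C. \<omega> * w - c) *
       ((\<Prod>z\<leftarrow>zs. weight_a z w) * (\<Prod>z\<leftarrow>zs. \<omega> * w - z)))"
    unfolding ratio ..
  also have "\<omega>\<^sup>2 * w - w = - (\<omega>\<^sup>2) * (\<omega> * w - w)"
    by (simp add: algebra_simps omega_simps)
  also have "- (\<omega>\<^sup>2) * (\<omega> * w - w) * Z' * ((\<Prod>c\<leftarrow>?C. weight_a (\<omega> * w) c) * (\<Prod>c\<leftarrow>?C. \<omega> * w - c) *
       ((\<Prod>z\<leftarrow>zs. weight_a z w) * (\<Prod>z\<leftarrow>zs. \<omega> * w - z))) = - (\<omega>\<^sup>2) * staircase_fn zs ws (\<omega> * w)"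
    unfolding staircase_fn_def 2 by (simp add: ws)
  finally show ?thesis .
qed

lemma omega_powers_inj: "inj_on (\<lambda>i. \<omega> ^ i) {..<3}"
proof -
  have "\<omega> \<noteq> 0" using omega_cubed by auto
  moreover have "\<omega>\<^sup>2 \<noteq> 1"
    using omega_cubed omega_neq_1 by (auto simp: power3_eq_cube power2_eq_square)
  moreover have "\<omega>\<^sup>2 \<noteq> \<omega>" using \<open>\<omega> \<noteq> 0\<close> omega_neq_1 by (simp add: power2_eq_square)
  moreover have "{..<3} = {0, 1, 2::nat}" by auto
  ultimately show ?thesis using omega_neq_1 by (auto simp: inj_on_def)
qed

text \<open>The left-hand side has degree at most \<open>3 n - 2\<close> in \<open>x\<close>, but vanishes at the \<open>3 n\<close> points
  \<open>\<omega>\<^sup>i w\<close> with \<open>w\<close> a column parameter.\<close>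

lemma staircase_fn_three_term_generic:
  assumes len: "length ws = Suc (length zs)"
    and dist: "distinct (map (\<lambda>w. w ^ 3) ws)" and nz: "0 \<notin> set ws"
  shows "staircase_fn zs ws x + \<omega> * staircase_fn zs ws (\<omega> * x) + \<omega>\<^sup>2 * staircase_fn zs ws (\<omega>\<^sup>2 * x) = 0"
proof -
  define G where "G = (\<lambda>x. staircase_fn zs ws x + \<omega> * staircase_fn zs ws (\<omega> * x) + \<omega>\<^sup>2 * staircase_fn zs ws (\<omega>\<^sup>2 * x))"
  \<comment> \<open>\<open>G\<close> is an eigenfunction of the rotation x -> \<omega> x, so one
    zero yields its whole orbit.\<close>
  have G_rot: "G (\<omega> * x) = \<omega>\<^sup>2 * G x" for x
  proof -
    have rot: "\<omega>\<^sup>2 * (\<omega> * x) = \<omega> ^ 3 * x" "\<omega> * (\<omega> * x) = \<omega>\<^sup>2 * x"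
      by (simp_all add: power2_eq_square power3_eq_cube)
    have "G (\<omega> * x) = staircase_fn zs ws (\<omega> * x) + \<omega> * staircase_fn zs ws (\<omega>\<^sup>2 * x) + \<omega>\<^sup>2 * staircase_fn zs ws x"
      unfolding G_def rot omega_cubed by simp
    then show ?thesis
      by (simp add: G_def algebra_simps omega_simps)
  qed
  \<comment> \<open>The first term vanishes through the factor x - w; the other two cancel because
    \<omega>^2 times -\<omega>^2 equals -\<omega>.\<close>
  have G_0: "G w = 0" if "w \<in> set ws" for w
  proof -
    have "staircase_fn zs ws w = 0"
      unfolding staircase_fn_def using that by (auto simp: prod_list_zero_iff)
    then show ?thesis
      unfolding G_def staircase_fn_at_column[OF len that dist] by (simp add: algebra_simps omega_simps)
  qed
  have G_pow: "G (\<omega> ^ i * w) = 0" if "w \<in> set ws" for i w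
  proof (induction i)
    case 0
    then show ?case using G_0[OF that] by simp
  next
    case (Suc i)
    then show ?case using G_rot[of "\<omega> ^ i * w"] by (simp add: mult.assoc)
  qed
  define S where "S = (\<lambda>(i, w). \<omega> ^ i * w) ` ({..<3} \<times> set ws)"
  have inj3: "inj_on (\<lambda>w. w ^ 3) (set ws)" using dist by (simp add: distinct_map)
  have "inj_on (\<lambda>(i, w). \<omega> ^ i * w) ({..<3} \<times> set ws)"
  proof (rule inj_onI)
    fix p q assume pq: "p \<in> {..<3} \<times> set ws" "q \<in> {..<3} \<times> set ws"
      and eq': "(\<lambda>(i, w). \<omega> ^ i * w) p = (\<lambda>(i, w). \<omega> ^ i * w) q"
    obtain i w j w' where [simp]: "p = (i, w)" "q = (j, w')" by (metis surj_pair)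
    have *: "i \<in> {..<3}" "w \<in> set ws" "j \<in> {..<3}" "w' \<in> set ws"
      and eq: "\<omega> ^ i * w = \<omega> ^ j * w'"
      using pq eq' by auto
    have cube: "(\<omega> ^ i * w) ^ 3 = w ^ 3" for i w
    proof -
      have "(\<omega> ^ i) ^ 3 = (\<omega> ^ 3) ^ i" by (simp only: power_mult [symmetric] mult.commute)
      then show ?thesis by (simp add: power_mult_distrib omega_cubed)
    qed
    have "w = w'" using * cube[of i w] cube[of j w'] eq inj3 by (simp add: inj_on_def)
    then have "\<omega> ^ i = \<omega> ^ j" using eq nz * by auto
    then show "p = q" using \<open>w = w'\<close> * omega_powers_inj by (simp add: inj_on_def)
  qed
  then have "card S = 3 * length ws"
    using dist by (simp add: S_def card_image card_cartesian_product distinct_card distinct_map)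
  moreover have "polynomial_below (length ws + length zs + length ws) G"
    unfolding G_def by (intro polynomial_below_add polynomial_below_cmult polynomial_below_staircase_fn polynomial_below_dilate)
  ultimately have "G x = 0"
    using G_pow len by - (rule polynomial_below_many_zeros[of _ G S], auto simp: S_def)
  then show ?thesis by (simp add: G_def)
qed

lemma isCont_row_weight:
  fixes f :: "real \<Rightarrow> nat \<Rightarrow> complex"
  assumes "\<And>i. isCont (\<lambda>e. f e i) e0"
  shows "isCont (\<lambda>e. row_weight x (map (f e) js) h vs vs' k) e0"
proof (induction js arbitrary: h vs vs')
  case (Cons i js)
  have "isCont (\<lambda>e. vertex_weight x (f e i) h v k v') e0" for h v k v'
    unfolding vertex_weight_def weight_a_def weight_b_def using assms[of i]
    by (cases h; cases v; cases k; cases v') (auto intro!: continuous_intros)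
  then show ?case using Cons.IH by (auto intro!: continuous_intros)
qed simp

lemma isCont_partition_fn:
  fixes f :: "real \<Rightarrow> nat \<Rightarrow> complex"
  assumes "\<And>i. isCont (\<lambda>e. f e i) e0"
  shows "isCont (\<lambda>e. partition_fn xs (map (f e) js) vs) e0"
  by (induction xs arbitrary: vs) (auto intro!: continuous_intros isCont_row_weight assms)

lemma isCont_staircase_fn:
  fixes f :: "real \<Rightarrow> nat \<Rightarrow> complex"
  assumes "\<And>i. isCont (\<lambda>e. f e i) e0"
  shows "isCont (\<lambda>e. staircase_fn zs (map (f e) js) x) e0"
proof -
  have "isCont (\<lambda>e. \<Prod>w\<leftarrow>map (f e) js. x - w) e0"
    by (induction js) (auto intro!: continuous_intros assms)
  then show ?thesis
    unfolding staircase_fn_def using isCont_partition_fn[where f = f and js = js and xs = "x # zs", OF assms] by (auto intro!: continuous_intros simp del: partition_fn.simps)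
qed

lemma staircase_fn_three_term:
  assumes "n = Suc (length zs)"
  shows "staircase_fn zs (replicate n 1) x + \<omega> * staircase_fn zs (replicate n 1) (\<omega> * x) +
     \<omega>\<^sup>2 * staircase_fn zs (replicate n 1) (\<omega>\<^sup>2 * x) = 0"
proof -
  \<comment> \<open>The generic case needs column parameters with distinct cubes; let these tend to 1.\<close>
  define f :: "real \<Rightarrow> nat \<Rightarrow> complex" where "f = (\<lambda>e i. of_real (1 + e * real i))"
  define G where "G = (\<lambda>e. staircase_fn zs (map (f e) [0..<n]) x + \<omega> * staircase_fn zs (map (f e) [0..<n]) (\<omega> * x) +
     \<omega>\<^sup>2 * staircase_fn zs (map (f e) [0..<n]) (\<omega>\<^sup>2 * x))"
  have "isCont (\<lambda>e. f e i) 0" for i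
    unfolding f_def by (auto intro!: continuous_intros)
  then have "isCont G 0"
    unfolding G_def by (intro continuous_intros isCont_staircase_fn)
  then have "(G \<longlongrightarrow> G 0) (at_right 0)"
    using filterlim_at_split isCont_def by blast
  moreover have "G e = 0" if "e > 0" for e
    unfolding G_def
  proof (rule staircase_fn_three_term_generic)
    have pos: "1 + e * real i > 0" for i using that by (simp add: add_pos_nonneg)
    \<comment> \<open>Positive reals are determined by their cubes, which is what the choice of
      \<open>f\<close> with \<open>e > 0\<close> secures.\<close>
    have "inj_on (\<lambda>i. f e i ^ 3) {0..<n}"
    proof (rule inj_onI)
      fix i j assume "f e i ^ 3 = f e j ^ 3"
      then have "(1 + e * real i) ^ 3 = (1 + e * real j) ^ 3"
        unfolding f_def of_real_power[symmetric] of_real_eq_iff .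
      then have "1 + e * real i = 1 + e * real j"
        using pos[of i] pos[of j] power_eq_imp_eq_base[of "1 + e * real i" 3 "1 + e * real j"] by simp
      then show "i = j" using that by simp
    qed
    then show "distinct (map (\<lambda>w. w ^ 3) (map (f e) [0..<n]))"
      by (simp add: distinct_map comp_def inj_on_def)
    have "f e i \<noteq> 0" for i
      using pos[of i] unfolding f_def of_real_eq_0_iff by simp
    then show "0 \<notin> set (map (f e) [0..<n])" by (metis (no_types) ex_map_conv)
  qed (use assms in simp)
  then have "eventually (\<lambda>e. G e = 0) (at_right 0)"
    by (auto simp: eventually_at_right_field intro: exI[of _ 1])
  then have "(G \<longlongrightarrow> 0) (at_right 0)"
    by (rule tendsto_eventually)
  ultimately have "G 0 = 0"
    by (intro tendsto_unique[of "at_right 0" G]) auto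
  moreover have "map (f 0) [0..<n] = replicate n 1"
    by (simp add: f_def map_replicate_const)
  ultimately show ?thesis by (simp add: G_def)
qed

text \<open>The three-term relation multiplies the coefficient of x^k by 1 + \<omega>^(k+1) +
  \<omega>^(2(k+1)), which is 3 for k = 2 modulo 3 and 0 otherwise. The second alternative is the
  degree bound.\<close>

lemma coeff_staircase_fn:
  assumes "n = Suc (length zs)" "\<And>x. poly p x = staircase_fn zs (replicate n 1) x"
    and "k mod 3 = 2 \<or> k \<ge> 3 * n - 1"
  shows "coeff p k = 0"
  using assms(3)
proof
  assume "k mod 3 = 2"
  let ?q = "p + smult \<omega> (pcompose p [:0, \<omega>:]) + smult (\<omega>\<^sup>2) (pcompose p [:0, \<omega>\<^sup>2:])"
  have "poly ?q x = 0" for x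
    using staircase_fn_three_term[OF assms(1), of x] by (simp add: poly_pcompose assms(2) mult.commute)
  then have "?q = 0" using poly_all_0_iff_0 by blast
  then have "coeff ?q k = 0" by simp
  moreover have "coeff ?q k = (1 + \<omega> ^ Suc k + \<omega> ^ (2 * Suc k)) * coeff p k"
    by (simp add: coeff_pcompose_linear algebra_simps power_mult power2_eq_square power_mult_distrib)
  moreover have "3 dvd Suc k" using \<open>k mod 3 = 2\<close> by presburger
  then have "\<omega> ^ Suc k = 1" by (metis dvd_def omega_cubed power_mult power_one)
  then have "\<omega> ^ (2 * Suc k) = 1" by (metis power_mult mult.commute power_one)
  ultimately show ?thesis using \<open>\<omega> ^ Suc k = 1\<close> by simp
next
  assume "k \<ge> 3 * n - 1"
  obtain q where "\<And>x. staircase_fn zs (replicate n 1) x = poly q x"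
    and q: "\<And>k. k \<ge> n + length zs + n \<Longrightarrow> coeff q k = 0"
    using polynomial_below_staircase_fn[of "replicate n 1" zs] unfolding polynomial_below_def by auto
  then have "p = q" using assms(2) poly_eq_poly_eq_iff by (metis ext)
  then show ?thesis using q[of k] \<open>k \<ge> 3 * n - 1\<close> assms(1) by simp
qed

section \<open>Alternating sign matrices as configurations\<close>

text \<open>This is what lets partial sums serve as two-valued edge states.\<close>

lemma alternating_partial_sums:
  fixes v :: "nat \<Rightarrow> int"
  assumes alt: "\<And>j k. j < k \<Longrightarrow> k < n \<Longrightarrow> v j \<noteq> 0 \<Longrightarrow> v k \<noteq> 0 \<Longrightarrow> (\<forall>l. j < l \<and> l < k \<longrightarrow> v l = 0) \<Longrightarrow> v k = - v j"
    and total: "(\<Sum>j<n. v j) = 1" and "k \<le> n"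
  shows "(\<Sum>j<k. v j) \<in> {0, 1}"
proof -
  have "\<exists>j. j < n \<and> v j \<noteq> 0" using total by (metis lessThan_iff sum.neutral zero_neq_one)
  define f where "f = (LEAST j. j < n \<and> v j \<noteq> 0)"
  have f: "f < n" "v f \<noteq> 0"
    using LeastI_ex[OF \<open>\<exists>j. j < n \<and> v j \<noteq> 0\<close>] unfolding f_def by auto
  have f_first: "v j = 0" if "j < f" for j
    using not_less_Least[OF that[unfolded f_def]] that f(1) by simp
  \<comment> \<open>The partial sums alternate between \<open>s\<close> and 0, and the total forces \<open>s = 1\<close>.\<close>
  define s where "s = v f"
  have *: "(\<forall>j<k. v j = 0) \<and> (\<Sum>j<k. v j) = 0 \<or>
    (\<exists>j<k. v j \<noteq> 0 \<and> (\<forall>l. j < l \<and> l < k \<longrightarrow> v l = 0) \<and>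
       (v j = s \<and> (\<Sum>j<k. v j) = s \<or> v j = - s \<and> (\<Sum>j<k. v j) = 0))" if "k \<le> n" for k
    using that
  proof (induction k)
    case 0
    then show ?case by simp
  next
    case (Suc k)
    show ?case
    proof (cases "v k = 0")
      case True
      then show ?thesis using Suc by (auto simp: less_Suc_eq)
    next
      case False
      from Suc have "(\<forall>j<k. v j = 0) \<and> (\<Sum>j<k. v j) = 0 \<or>
        (\<exists>j<k. v j \<noteq> 0 \<and> (\<forall>l. j < l \<and> l < k \<longrightarrow> v l = 0) \<and>
         (v j = s \<and> (\<Sum>j<k. v j) = s \<or> v j = - s \<and> (\<Sum>j<k. v j) = 0))" by simp
      then show ?thesis
      proof
        assume *: "(\<forall>j<k. v j = 0) \<and> (\<Sum>j<k. v j) = 0"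
        then have "f = k" using f f_first False Suc.prems by (metis not_less_iff_gr_or_eq)
        then show ?thesis using * False by (intro disjI2 exI[of _ k]) (auto simp: s_def)
      next
        assume "\<exists>j<k. v j \<noteq> 0 \<and> (\<forall>l. j < l \<and> l < k \<longrightarrow> v l = 0) \<and>
         (v j = s \<and> (\<Sum>j<k. v j) = s \<or> v j = - s \<and> (\<Sum>j<k. v j) = 0)"
        then obtain j where j: "j < k" "v j \<noteq> 0" "\<forall>l. j < l \<and> l < k \<longrightarrow> v l = 0"
          "v j = s \<and> (\<Sum>j<k. v j) = s \<or> v j = - s \<and> (\<Sum>j<k. v j) = 0" by blast
        then have "v k = - v j" using alt[of j k] False Suc.prems by auto
        then show ?thesis using j False by (intro disjI2 exI[of _ k]) auto
      qed
    qed
  qed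
  have "s = 1" using *[of n] total by auto
  then show ?thesis using *[OF \<open>k \<le> n\<close>] by auto
qed

lemma partial_sums_alternating:
  fixes v :: "nat \<Rightarrow> int"
  assumes ps: "\<And>k. k \<le> n \<Longrightarrow> (\<Sum>j<k. v j) \<in> {0, 1}"
    and "j < k" "k < n" "v j \<noteq> 0" "v k \<noteq> 0" "\<forall>l. j < l \<and> l < k \<longrightarrow> v l = 0"
  shows "v k = - v j"
proof -
  have "(\<Sum>l<k. v l) = (\<Sum>l<Suc j. v l) + (\<Sum>l=Suc j..<k. v l)"
    using assms(2) by (metis Suc_leI atLeast0LessThan sum.atLeastLessThan_concat zero_le)
  also have "(\<Sum>l=Suc j..<k. v l) = 0" using assms(6) by (intro sum.neutral) auto
  finally have "(\<Sum>l<k. v l) = (\<Sum>l<j. v l) + v j" by simp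
  then show ?thesis
    using ps[of j] ps[of "Suc j"] ps[of k] ps[of "Suc k"] assms(2-5) by auto
qed

lemma asm_line_iff:
  "asm_line v \<longleftrightarrow> (\<forall>k\<le>dim_vec v. (\<Sum>j<k. v $ j) \<in> {0, 1}) \<and> (\<Sum>j<dim_vec v. v $ j) = 1"
  unfolding asm_line_def alternating_vec_def
  using alternating_partial_sums[of "dim_vec v" "\<lambda>j. v $ j"]
    partial_sums_alternating[of "dim_vec v" "\<lambda>j. v $ j"] by blast

text \<open>An automaton whose state \<open>h\<close> is the partial sum so far; it has the shape of
  the recursion of \<open>row_weight\<close>, so the two can be compared by induction.\<close>

primrec asm_list :: "bool \<Rightarrow> int list \<Rightarrow> bool" where
  "asm_list h [] = h"
| "asm_list h (x # xs) = (\<exists>h'. x = of_bool h' - of_bool h \<and> asm_list h' xs)"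

lemma asm_list_iff_partial_sums:
  "asm_list h xs \<longleftrightarrow> (\<forall>k\<le>length xs. of_bool h + (\<Sum>j<k. xs ! j) \<in> {0, 1}) \<and>
     of_bool h + (\<Sum>j<length xs. xs ! j) = 1"
proof (induction xs arbitrary: h)
  case Nil
  then show ?case by auto
next
  case (Cons x xs)
  have all: "(\<forall>k\<le>Suc m. P k) \<longleftrightarrow> P 0 \<and> (\<forall>k\<le>m. P (Suc k))" for P m
    by (metis Suc_le_mono le0 not0_implies_Suc)
  have sum: "(\<Sum>j<Suc k. (x # xs) ! j) = x + (\<Sum>j<k. xs ! j)" for k
    unfolding sum.lessThan_Suc_shift by simp
  have "(\<exists>h'. x = of_bool h' - of_bool h \<and> Q h') \<longleftrightarrow>
     of_bool h + x \<in> {0, 1} \<and> Q (of_bool h + x = 1)" for Q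
    unfolding ex_bool_eq by (cases h; cases "x = 0"; cases "x = 1"; cases "x = -1"; simp)
  then have "asm_list h (x # xs) \<longleftrightarrow> of_bool h + x \<in> {0, 1} \<and> asm_list (of_bool h + x = 1) xs"
    by simp
  also have "\<dots> \<longleftrightarrow> (\<forall>k\<le>length (x # xs). of_bool h + (\<Sum>j<k. (x # xs) ! j) \<in> {0, 1}) \<and>
     of_bool h + (\<Sum>j<length (x # xs). (x # xs) ! j) = 1"
  proof -
    define c where "c = of_bool h + x"
    have 1: "(\<forall>k\<le>length (x # xs). of_bool h + (\<Sum>j<k. (x # xs) ! j) \<in> {0, 1}) \<longleftrightarrow>
        (\<forall>k\<le>length xs. c + (\<Sum>j<k. xs ! j) \<in> {0, 1})"
      unfolding length_Cons all sum c_def by (simp add: add.assoc)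
    have 2: "of_bool h + (\<Sum>j<length (x # xs). (x # xs) ! j) = c + (\<Sum>j<length xs. xs ! j)"
      unfolding length_Cons sum c_def by simp
    show ?thesis
      unfolding 1 2 c_def[symmetric]
    proof (cases "c \<in> {0, 1}")
      case True
      then have "of_bool (c = 1) = c" by auto
      then show "(c \<in> {0, 1} \<and> asm_list (c = 1) xs) \<longleftrightarrow>
          (\<forall>k\<le>length xs. c + (\<Sum>j<k. xs ! j) \<in> {0, 1}) \<and> c + (\<Sum>j<length xs. xs ! j) = 1"
        using True Cons.IH[of "c = 1"] by simp
    next
      case False
      then have "\<not> (\<forall>k\<le>length xs. c + (\<Sum>j<k. xs ! j) \<in> {0, 1})"
        by (auto intro!: exI[of _ 0])
      then show "(c \<in> {0, 1} \<and> asm_list (c = 1) xs) \<longleftrightarrow>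
          (\<forall>k\<le>length xs. c + (\<Sum>j<k. xs ! j) \<in> {0, 1}) \<and> c + (\<Sum>j<length xs. xs ! j) = 1"
        using False by blast
    qed
  qed
  finally show ?case .
qed

lemma asm_line_iff_asm_list: "asm_line (vec_of_list xs) \<longleftrightarrow> asm_list False xs"
proof -
  have "(\<Sum>j<k. vec_of_list xs $ j) = (\<Sum>j<k. xs ! j)" for k
    by (simp add: vec_of_list_index)
  then show ?thesis unfolding asm_line_iff asm_list_iff_partial_sums by simp
qed

lemma asm_list_entries: "asm_list h xs \<Longrightarrow> set xs \<subseteq> {-1, 0, 1}"
proof (induction xs arbitrary: h)
  case (Cons x xs)
  then obtain h' where "x = of_bool h' - of_bool h" "asm_list h' xs" by auto
  then show ?case using Cons.IH[of h'] by (cases h; cases h') auto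
qed simp

definition increments :: "bool list \<Rightarrow> bool list \<Rightarrow> int list" where
  "increments vs vs' = map2 (\<lambda>v v'. of_bool v' - of_bool v) vs vs'"

lemma increments_Cons [simp]:
  "increments (v # vs) (v' # vs') = (of_bool v' - of_bool v) # increments vs vs'"
  by (simp add: increments_def)

lemma increments_Nil [simp]: "increments [] vs' = []"
  by (simp add: increments_def)

lemma row_weight_homogeneous:
  "length vs' = length vs \<Longrightarrow>
   row_weight 1 (replicate (length vs) 1) h vs vs' True = of_bool (asm_list h (increments vs vs'))"
proof (induction vs arbitrary: h vs')
  case (Cons v vs)
  then obtain v' V where vs': "vs' = v' # V" "length V = length vs" by (auto simp: length_Suc_conv)
  have "weight_a 1 1 = 1" "weight_b 1 1 = 1" by (simp_all add: weight_a_def weight_b_def)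
  then show ?case
    by (cases h; cases v; cases v') (simp_all add: vs' Cons.IH vertex_weight_def ex_bool_eq)
qed simp

text \<open>With \<open>False\<close> above, the edges left of the 1 agree (\<open>weight_a\<close>)
  and those right of it differ (\<open>weight_b\<close>); the sum over \<open>i\<close> merely
  selects the position of the 1.\<close>

lemma row_weight_from_bottom:
  assumes "length vs' = n"
  shows "row_weight x (replicate n 1) False (replicate n False) vs' True =
     of_bool (asm_list False (increments (replicate n False) vs')) *
     (\<Sum>i<n. of_bool (increments (replicate n False) vs' ! i = 1) * (weight_a x 1 ^ i * weight_b x 1 ^ (n - Suc i)))"
  using assms
proof (induction n arbitrary: vs')
  case (Suc n)
  then obtain v' V where vs': "vs' = v' # V" "length V = n" by (auto simp: length_Suc_conv)
  have T: "asm_list True (increments (replicate n False) V) \<longleftrightarrow> V = replicate n False" if "length V = n" for V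
    using that
  proof (induction n arbitrary: V)
    case (Suc n)
    then obtain a A where "V = a # A" "length A = n" by (auto simp: length_Suc_conv)
    then show ?case using Suc.IH[of A] by (cases a) (auto simp: ex_bool_eq)
  qed simp
  have Z: "increments (replicate n False) (replicate n False) ! i \<noteq> 1" if "i < n" for i
    using that by (simp add: increments_def)
  show ?case
  proof (cases v')
    case True
    have "(\<Sum>i<Suc n. of_bool (increments (replicate (Suc n) False) vs' ! i = 1) * (weight_a x 1 ^ i * weight_b x 1 ^ (Suc n - Suc i)))
       = weight_b x 1 ^ n" if "V = replicate n False"
      unfolding sum.lessThan_Suc_shift
      by (simp add: vs' True that Z del: sum_of_bool_mult_eq cong: sum.cong_simp)
    then show ?thesis
      using True row_weight_after_one[of V "replicate n 1" x] vs' T[OF vs'(2)]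
      by (auto simp: vertex_weight_def ex_bool_eq)
  next
    case False
    then show ?thesis
      unfolding sum.lessThan_Suc_shift
      by (simp add: Suc.IH[OF vs'(2)] vertex_weight_def ex_bool_eq vs' sum_distrib_left mult_ac
          del: sum_of_bool_mult_eq sum_mult_of_bool_eq)
  qed
qed simp

text \<open>In the last row the edges below are \<open>True\<close>, so \<open>weight_a\<close> and
  \<open>weight_b\<close> change sides relative to the first row.\<close>

lemma row_weight_to_top:
  assumes "length vs = n"
  shows "row_weight y (replicate n 1) False vs (replicate n True) True =
     of_bool (asm_list False (increments vs (replicate n True))) *
     (\<Sum>i<n. of_bool (increments vs (replicate n True) ! i = 1) * (weight_b y 1 ^ i * weight_a y 1 ^ (n - Suc i)))"
  using assms
proof (induction n arbitrary: vs)
  case (Suc n)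
  then obtain v V where vs: "vs = v # V" "length V = n" by (auto simp: length_Suc_conv)
  have T: "asm_list True (increments V (replicate n True)) \<longleftrightarrow> V = replicate n True" if "length V = n" for V
    using that
  proof (induction n arbitrary: V)
    case (Suc n)
    then obtain a A where "V = a # A" "length A = n" by (auto simp: length_Suc_conv)
    then show ?case using Suc.IH[of A] by (cases a) (auto simp: ex_bool_eq)
  qed simp
  have W: "row_weight y (replicate n 1) True V (replicate n True) True =
      (if V = replicate n True then weight_a y 1 ^ n else 0)" if "length V = n" for V
    using that
  proof (induction n arbitrary: V)
    case (Suc n)
    then obtain a A where "V = a # A" "length A = n" by (auto simp: length_Suc_conv)
    then show ?case using Suc.IH[of A] by (auto simp: vertex_weight_def)
  qed simp
  have Z: "increments (replicate n True) (replicate n True) ! i \<noteq> 1" if "i < n" for i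
    using that by (simp add: increments_def)
  show ?case
  proof (cases v)
    case False
    have "(\<Sum>i<Suc n. of_bool (increments vs (replicate (Suc n) True) ! i = 1) * (weight_b y 1 ^ i * weight_a y 1 ^ (Suc n - Suc i)))
       = weight_a y 1 ^ n" if "V = replicate n True"
      unfolding sum.lessThan_Suc_shift
      by (simp add: vs False that Z del: sum_of_bool_mult_eq cong: sum.cong_simp)
    then show ?thesis
      using False W[OF vs(2)] vs T[OF vs(2)]
      by (auto simp: vertex_weight_def ex_bool_eq)
  next
    case True
    then show ?thesis
      unfolding sum.lessThan_Suc_shift
      by (simp add: Suc.IH[OF vs(2)] vertex_weight_def ex_bool_eq vs sum_distrib_left mult_ac
          del: sum_of_bool_mult_eq sum_mult_of_bool_eq)
  qed
qed simp

text \<open>The lower \<open>k\<close> rows of a matrix whose columns already have partial sums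
  \<open>vs\<close>; arbitrary initial sums allow rows to be peeled off at the top.\<close>

definition row_lists :: "nat \<Rightarrow> bool list \<Rightarrow> int list list set" where
  "row_lists k vs = {R. length R = k \<and> (\<forall>r\<in>set R. length r = length vs \<and> asm_list False r) \<and>
     (\<forall>j<length vs. asm_list (vs ! j) (map (\<lambda>r. r ! j) R))}"

text \<open>The recursion of \<open>partition_fn\<close> with the weight of each row replaced by a
  function of its entries, so that the first and last rows can be weighted differently from the
  rest.\<close>

primrec weighted_count :: "(int list \<Rightarrow> complex) list \<Rightarrow> bool list \<Rightarrow> complex" where
  "weighted_count [] vs = of_bool (\<forall>v\<in>set vs. v)"
| "weighted_count (f # fs) vs = (\<Sum>vs'\<in>bool_lists (length vs).
     of_bool (asm_list False (increments vs vs')) * f (increments vs vs') * weighted_count fs vs')"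

lemma finite_row_lists: "finite (row_lists k vs)"
proof (rule finite_subset)
  show "row_lists k vs \<subseteq> {R. set R \<subseteq> {r. set r \<subseteq> {-1, 0, 1} \<and> length r = length vs} \<and> length R = k}"
    using asm_list_entries by (fastforce simp: row_lists_def)
  show "finite \<dots>"
    by (intro finite_lists_length_eq) auto
qed

lemma row_lists_Suc:
  "(\<Sum>R\<in>row_lists (Suc k) vs. F (hd R) (tl R)) =
     (\<Sum>vs'\<in>bool_lists (length vs). of_bool (asm_list False (increments vs vs')) *
        (\<Sum>R\<in>row_lists k vs'. F (increments vs vs') R))" for F :: "_ \<Rightarrow> _ \<Rightarrow> complex"
proof -
  let ?B = "{vs'\<in>bool_lists (length vs). asm_list False (increments vs vs')}"
  have "(\<Sum>vs'\<in>bool_lists (length vs). of_bool (asm_list False (increments vs vs')) *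
        (\<Sum>R\<in>row_lists k vs'. F (increments vs vs') R)) =
      (\<Sum>vs'\<in>?B. \<Sum>R\<in>row_lists k vs'. F (increments vs vs') R)"
    by (rule sum.mono_neutral_cong_right) auto
  also have "\<dots> = (\<Sum>(vs', R)\<in>Sigma ?B (row_lists k). F (increments vs vs') R)"
    by (rule sum.Sigma) (auto simp: finite_row_lists)
  also have "\<dots> = (\<Sum>R\<in>row_lists (Suc k) vs. F (hd R) (tl R))"
  proof (rule sum.reindex_bij_witness[where
        i = "\<lambda>R. (map2 (\<lambda>v x. of_bool v + x = 1) vs (hd R), tl R)" and
        j = "\<lambda>(vs', R). increments vs vs' # R"])
    fix R assume R: "R \<in> row_lists (Suc k) vs"
    then obtain r S where RS: "R = r # S" by (auto simp: row_lists_def length_Suc_conv)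
    \<comment> \<open>The partial sum after adding the entry is 0 or 1, and the state below records
      whether it is 1.\<close>
    let ?v = "map2 (\<lambda>v x. of_bool v + x = 1) vs r"
    have len: "length r = length vs" using R by (simp add: row_lists_def RS)
    have *: "\<exists>h'. r ! j = of_bool h' - of_bool (vs ! j) \<and> asm_list h' (map (\<lambda>r. r ! j) S)"
      if "j < length vs" for j
      using R that by (simp add: row_lists_def RS)
    have v: "r ! j = of_bool (?v ! j) - of_bool (vs ! j) \<and> asm_list (?v ! j) (map (\<lambda>r. r ! j) S)"
      if j: "j < length vs" for j
    proof -
      obtain h' where h': "r ! j = of_bool h' - of_bool (vs ! j)" "asm_list h' (map (\<lambda>r. r ! j) S)"
        using *[OF j] by blast
      then have "?v ! j = h'" using j len by (cases h'; cases "vs ! j") auto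
      then show ?thesis using h' by simp
    qed
    have inc: "increments vs ?v = r"
      using v len by (auto simp: increments_def intro!: nth_equalityI)
    show "(case (map2 (\<lambda>v x. of_bool v + x = 1) vs (hd R), tl R) of (vs', R) \<Rightarrow> increments vs vs' # R) = R"
      using inc by (simp add: RS)
    show "(map2 (\<lambda>v x. of_bool v + x = 1) vs (hd R), tl R) \<in> Sigma ?B (row_lists k)"
    proof -
      have "length ?v = length vs" using len by simp
      moreover have "asm_list False r" using R by (simp add: row_lists_def RS)
      moreover have "S \<in> row_lists k ?v"
        unfolding row_lists_def
      proof (intro CollectI conjI allI impI)
        fix j assume "j < length ?v"
        then show "asm_list (?v ! j) (map (\<lambda>r. r ! j) S)" using v[of j] len by simp
      qed (use R len in \<open>auto simp: row_lists_def RS\<close>)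
      ultimately show ?thesis by (simp only: RS list.sel inc bool_lists_def mem_Sigma_iff mem_Collect_eq)
    qed
  next
    fix p assume p: "p \<in> Sigma ?B (row_lists k)"
    then obtain vs' R where pR: "p = (vs', R)" "length vs' = length vs" "asm_list False (increments vs vs')"
       "R \<in> row_lists k vs'" by (auto simp: bool_lists_def)
    have "map2 (\<lambda>v x. of_bool v + x = (1::int)) vs (increments vs vs') = vs'"
      using pR(2) by (auto simp: increments_def intro!: nth_equalityI)
    then show "(\<lambda>R. (map2 (\<lambda>v x. of_bool v + x = 1) vs (hd R), tl R))
        (case p of (vs', R) \<Rightarrow> increments vs vs' # R) = p"
      by (simp add: pR)
    show "(case p of (vs', R) \<Rightarrow> increments vs vs' # R) \<in> row_lists (Suc k) vs"
      using pR by (auto simp: row_lists_def increments_def)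
    show "F (hd (case p of (vs', R) \<Rightarrow> increments vs vs' # R)) (tl (case p of (vs', R) \<Rightarrow> increments vs vs' # R)) =
       (case p of (vs', R) \<Rightarrow> F (increments vs vs') R)"
      by (simp add: pR)
  qed
  finally show ?thesis ..
qed

lemma weighted_count_eq:
  "weighted_count fs vs = (\<Sum>R\<in>row_lists (length fs) vs. \<Prod>(f, r)\<leftarrow>zip fs R. f r)"
proof (induction fs arbitrary: vs)
  case Nil
  have "row_lists 0 vs = (if \<forall>v\<in>set vs. v then {[]} else {})"
    by (auto simp: row_lists_def all_set_conv_all_nth)
  then show ?case by simp
next
  case (Cons f fs)
  have "(\<Sum>R\<in>row_lists (length (f # fs)) vs. \<Prod>(f, r)\<leftarrow>zip (f # fs) R. f r) =
     (\<Sum>R\<in>row_lists (Suc (length fs)) vs. f (hd R) * (\<Prod>(f, r)\<leftarrow>zip fs (tl R). f r))"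
    by (intro sum.cong) (auto simp: row_lists_def length_Suc_conv)
  also have "\<dots> = weighted_count (f # fs) vs"
    unfolding row_lists_Suc[where F = "\<lambda>r R. f r * (\<Prod>(f, r)\<leftarrow>zip fs R. f r)"]
    by (simp add: Cons.IH sum_distrib_left mult_ac)
  finally show ?case ..
qed

lemma partition_fn_weighted_count_step:
  assumes "\<And>vs'. length vs' = length vs \<Longrightarrow>
      row_weight x (replicate (length vs) 1) False vs vs' True =
      of_bool (asm_list False (increments vs vs')) * f (increments vs vs')"
    and "\<And>vs'. length vs' = length vs \<Longrightarrow>
      partition_fn xs (replicate (length vs) 1) vs' = weighted_count fs vs'"
  shows "partition_fn (x # xs) (replicate (length vs) 1) vs = weighted_count (f # fs) vs"
  using assms by (auto intro!: sum.cong simp: bool_lists_def)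

lemma partition_fn_weighted_count_ones:
  assumes "\<And>vs'. length vs' = length vs \<Longrightarrow>
      partition_fn xs (replicate (length vs) 1) vs' = weighted_count fs vs'"
  shows "partition_fn (replicate k 1 @ xs) (replicate (length vs) 1) vs =
     weighted_count (replicate k (\<lambda>_. 1) @ fs) vs"
  using assms
proof (induction k arbitrary: vs)
  case (Suc k)
  show ?case
    unfolding replicate_Suc append_Cons
  proof (rule partition_fn_weighted_count_step)
    fix vs' :: "bool list" assume len: "length vs' = length vs"
    then have "partition_fn (replicate k 1 @ xs) (replicate (length vs') 1) vs' =
       weighted_count (replicate k (\<lambda>_. 1) @ fs) vs'"
      using Suc.prems by (intro Suc.IH) simp
    then show "partition_fn (replicate k 1 @ xs) (replicate (length vs) 1) vs' =
       weighted_count (replicate k (\<lambda>_. 1) @ fs) vs'"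
      by (simp add: len)
  qed (simp add: row_weight_homogeneous)
qed simp

lemma partition_fn_ones: "partition_fn (replicate k 1) (replicate (length vs) 1) vs = weighted_count (replicate k (\<lambda>_. 1)) vs"
  using partition_fn_weighted_count_ones[of vs "[]" "[]" k] by simp

lemma all_True_iff: "length vs = n \<Longrightarrow> (\<forall>v\<in>set vs. v) \<longleftrightarrow> vs = replicate n True"
  by (metis (full_types) in_set_replicate replicate_eqI)

lemma weighted_count_last:
  "weighted_count [f] vs = of_bool (asm_list False (increments vs (replicate (length vs) True))) *
     f (increments vs (replicate (length vs) True))"
proof -
  have "weighted_count [f] vs = (\<Sum>vs'\<in>bool_lists (length vs). if vs' = replicate (length vs) True
     then of_bool (asm_list False (increments vs vs')) * f (increments vs vs') else 0)"
    unfolding weighted_count.simps by (intro sum.cong refl) (simp add: bool_lists_def all_True_iff)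
  also have "\<dots> = of_bool (asm_list False (increments vs (replicate (length vs) True))) *
     f (increments vs (replicate (length vs) True))"
    by (rule sum_bool_lists_delta) simp
  finally show ?thesis .
qed

lemma partition_fn_last: "length vs = length ws \<Longrightarrow>
  partition_fn [y] ws vs = row_weight y ws False vs (replicate (length vs) True) True"
proof -
  assume len: "length vs = length ws"
  have "partition_fn [y] ws vs = (\<Sum>vs'\<in>bool_lists (length ws). if vs' = replicate (length vs) True
     then row_weight y ws False vs vs' True else 0)"
    unfolding partition_fn.simps by (intro sum.cong refl) (simp add: bool_lists_def len all_True_iff)
  also have "\<dots> = row_weight y ws False vs (replicate (length vs) True) True"
    by (rule sum_bool_lists_delta) (simp add: len)
  finally show ?thesis .
qed

lemma sum_row_lists_ASM:
  "(\<Sum>R\<in>row_lists n (replicate n False). F R) =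
     (\<Sum>M\<in>ASM n. F (map (\<lambda>i. map (\<lambda>j. M $$ (i, j)) [0..<n]) [0..<n]))"
proof (rule sum.reindex_bij_witness[where
      i = "\<lambda>M. map (\<lambda>i. map (\<lambda>j. M $$ (i, j)) [0..<n]) [0..<n]" and
      j = "\<lambda>R. mat n n (\<lambda>(i, j). R ! i ! j)"])
  fix R assume R: "R \<in> row_lists n (replicate n False)"
  let ?M = "mat n n (\<lambda>(i, j). R ! i ! j)"
  have len: "length R = n" "\<And>i. i < n \<Longrightarrow> length (R ! i) = n" "\<And>i. i < n \<Longrightarrow> asm_list False (R ! i)"
    using R by (auto simp: row_lists_def)
  have col: "asm_list False (map (\<lambda>r. r ! j) R)" if "j < n" for j
    using R that by (auto simp: row_lists_def)
  show inv: "map (\<lambda>i. map (\<lambda>j. ?M $$ (i, j)) [0..<n]) [0..<n] = R"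
    using len by (auto intro!: nth_equalityI)
  have row_eq: "row ?M i = vec_of_list (R ! i)" if "i < n" for i
    using that len by (auto simp: vec_of_list_index)
  have "asm_line (row ?M i)" if "i < n" for i
    unfolding row_eq[OF that] asm_line_iff_asm_list by (rule len(3)[OF that])
  moreover have col_eq: "col ?M j = vec_of_list (map (\<lambda>r. r ! j) R)" if "j < n" for j
    using that len by (auto simp: vec_of_list_index simp del: vec_of_list_map)
  have "asm_line (col ?M j)" if "j < n" for j
    unfolding col_eq[OF that] asm_line_iff_asm_list by (rule col[OF that])
  moreover have "R ! i ! j \<in> {-1, 0, 1}" if "i < n" "j < n" for i j
    using asm_list_entries[OF len(3)[OF that(1)]] that len by (metis nth_mem subsetD)
  ultimately show "?M \<in> ASM n"
    by (simp add: ASM_def)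
  show "F (map (\<lambda>i. map (\<lambda>j. ?M $$ (i, j)) [0..<n]) [0..<n]) = F R"
    unfolding inv ..
next
  fix M assume M: "M \<in> ASM n"
  let ?R = "map (\<lambda>i. map (\<lambda>j. M $$ (i, j)) [0..<n]) [0..<n]"
  have dim: "dim_row M = n" "dim_col M = n" using M by (auto simp: ASM_def)
  then show "mat n n (\<lambda>(i, j). ?R ! i ! j) = M" by auto
  have row_eq: "row M i = vec_of_list (map (\<lambda>j. M $$ (i, j)) [0..<n])" if "i < n" for i
    using that dim by (auto simp: vec_of_list_index simp del: vec_of_list_map)
  have col_eq: "col M j = vec_of_list (map (\<lambda>i. M $$ (i, j)) [0..<n])" if "j < n" for j
    using that dim by (auto simp: vec_of_list_index simp del: vec_of_list_map)
  have "asm_line (row M i)" "asm_line (col M i)" if "i < n" for i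
    using M that by (auto simp: ASM_def)
  then have "asm_list False (map (\<lambda>j. M $$ (i, j)) [0..<n])"
      "asm_list False (map (\<lambda>j. M $$ (j, i)) [0..<n])" if "i < n" for i
    unfolding asm_line_iff_asm_list[symmetric] row_eq[OF that, symmetric] col_eq[OF that, symmetric]
    using that by auto
  then show "?R \<in> row_lists n (replicate n False)"
    by (auto simp: row_lists_def comp_def)
qed

lemma finite_ASM: "finite (ASM n)"
proof -
  let ?L = "{R. set R \<subseteq> {r. set r \<subseteq> {-1, 0, 1::int} \<and> length r = n} \<and> length R = n}"
  have "ASM n \<subseteq> (\<lambda>R. mat n n (\<lambda>(i, j). R ! i ! j)) ` ?L"
  proof
    fix M assume M: "M \<in> ASM n"
    let ?R = "map (\<lambda>i. map (\<lambda>j. M $$ (i, j)) [0..<n]) [0..<n]"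
    have entry: "M $$ (i, j) \<in> {-1, 0, 1}" if "i < n" "j < n" for i j
      using that M by (simp add: ASM_def)
    then have "set (map (\<lambda>j. M $$ (i, j)) [0..<n]) \<subseteq> {-1, 0, 1}" if "i < n" for i
      unfolding set_map using that by (intro image_subsetI) auto
    then have "set ?R \<subseteq> {r. set r \<subseteq> {-1, 0, 1} \<and> length r = n}"
      unfolding set_map[of _ "[0..<n]"] by (intro image_subsetI) simp
    then have "?R \<in> ?L" by simp
    moreover have "M = mat n n (\<lambda>(i, j). ?R ! i ! j)" using M by (auto simp: ASM_def)
    ultimately show "M \<in> (\<lambda>R. mat n n (\<lambda>(i, j). R ! i ! j)) ` ?L" by blast
  qed
  moreover have "finite ?L"
    by (intro finite_lists_length_eq) auto
  ultimately show ?thesis by (rule finite_surj[rotated])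
qed

lemma partition_fn_asm_count: "partition_fn (replicate n 1) (replicate n 1) (replicate n False) = of_nat (asm_count n)"
proof -
  have "prod_list (map (\<lambda>(f, r). f r) (zip (replicate k (\<lambda>_. 1)) R)) = (1::complex)" if "length R = k" for k and R :: "int list list"
    using that by (induction k arbitrary: R) (auto simp: length_Suc_conv)
  then have "weighted_count (replicate n (\<lambda>_. 1)) (replicate n False) = (\<Sum>R\<in>row_lists n (replicate n False). 1)"
    unfolding weighted_count_eq by (intro sum.cong) (auto simp: row_lists_def)
  also have "\<dots> = of_nat (asm_count n)"
    unfolding sum_row_lists_ASM by (simp add: asm_count_def)
  finally show ?thesis
    using partition_fn_ones[of n "replicate n False"] by simp
qed

text \<open>Only the first row (through \<open>f\<close>) and the last row (through
  \<open>g\<close>) depend on the spectral parameters; rows with parameter 1 have weight 1. The form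
  of \<open>n\<close> makes these two rows distinct.\<close>

lemma partition_fn_doubly_refined:
  assumes "n = Suc (Suc m)"
  shows "partition_fn (x # replicate m 1 @ [y]) (replicate n 1) (replicate n False) =
     (\<Sum>i<n. \<Sum>j<n. of_nat (doubly_refined_count n i j) *
        ((weight_a x 1 ^ i * weight_b x 1 ^ (n - Suc i)) * (weight_b y 1 ^ j * weight_a y 1 ^ (n - Suc j))))"
proof -
  define f where "f = (\<lambda>r :: int list. \<Sum>i<n. of_bool (r ! i = 1) * (weight_a x 1 ^ i * weight_b x 1 ^ (n - Suc i)))"
  define g where "g = (\<lambda>r :: int list. \<Sum>i<n. of_bool (r ! i = 1) * (weight_b y 1 ^ i * weight_a y 1 ^ (n - Suc i)))"
  have last: "partition_fn [y] (replicate n 1) vs = weighted_count [g] vs" if "length vs = n" for vs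
    using that row_weight_to_top[OF that, of y]
    by (simp add: partition_fn_last weighted_count_last g_def del: partition_fn.simps weighted_count.simps)
  have "partition_fn (x # replicate m 1 @ [y]) (replicate n 1) (replicate n False) =
     weighted_count (f # replicate m (\<lambda>_. 1) @ [g]) (replicate n False)"
  proof (rule partition_fn_weighted_count_step[where vs = "replicate n False", unfolded length_replicate])
    fix vs' :: "bool list" assume len: "length vs' = n"
    show "row_weight x (replicate n 1) False (replicate n False) vs' True =
       of_bool (asm_list False (increments (replicate n False) vs')) * f (increments (replicate n False) vs')"
      unfolding f_def by (rule row_weight_from_bottom[OF len])
    show "partition_fn (replicate m 1 @ [y]) (replicate n 1) vs' = weighted_count (replicate m (\<lambda>_. 1) @ [g]) vs'"
      using partition_fn_weighted_count_ones[of vs' "[y]" "[g]" m] last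
      by (simp add: len del: partition_fn.simps weighted_count.simps)
  qed
  also have "\<dots> = (\<Sum>R\<in>row_lists n (replicate n False). f (R ! 0) * g (R ! (n - 1)))"
  proof -
    have "prod_list (map (\<lambda>(f, r). f r) (zip (replicate k (\<lambda>_. 1) @ [g]) R)) = g (R ! k)"
      if "length R = Suc k" for k and R :: "int list list"
      using that by (induction k arbitrary: R) (auto simp: length_Suc_conv)
    then show ?thesis
      unfolding weighted_count_eq
      by (intro sum.cong) (auto simp: row_lists_def assms length_Suc_conv)
  qed
  also have "\<dots> = (\<Sum>M\<in>ASM n. \<Sum>i<n. \<Sum>j<n. of_bool (M $$ (0, i) = 1 \<and> M $$ (n - 1, j) = 1) *
      ((weight_a x 1 ^ i * weight_b x 1 ^ (n - Suc i)) * (weight_b y 1 ^ j * weight_a y 1 ^ (n - Suc j))))"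
    unfolding sum_row_lists_ASM f_def g_def sum_product
    by (intro sum.cong refl) (simp add: assms of_bool_conj mult_ac del: upt_Suc)
  also have "\<dots> = (\<Sum>i<n. \<Sum>j<n. \<Sum>M\<in>ASM n. of_bool (M $$ (0, i) = 1 \<and> M $$ (n - 1, j) = 1) *
      ((weight_a x 1 ^ i * weight_b x 1 ^ (n - Suc i)) * (weight_b y 1 ^ j * weight_a y 1 ^ (n - Suc j))))"
    by (subst sum.swap) (intro sum.cong refl sum.swap)
  also have "\<dots> = (\<Sum>i<n. \<Sum>j<n. of_nat (doubly_refined_count n i j) *
        ((weight_a x 1 ^ i * weight_b x 1 ^ (n - Suc i)) * (weight_b y 1 ^ j * weight_a y 1 ^ (n - Suc j))))"
    by (simp add: doubly_refined_count_def finite_ASM sum_distrib_right[symmetric] of_bool_def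
        sum.If_cases Int_def)
  finally show ?thesis .
qed

section \<open>Half-turn symmetry\<close>

lemma asm_line_reverse:
  assumes "asm_line v" "dim_vec v = n"
  shows "asm_line (vec n (\<lambda>j. v $ (n - Suc j)))"
  unfolding asm_line_def alternating_vec_def
proof (intro conjI allI impI)
  fix j k
  assume *: "j < k \<and> k < dim_vec (vec n (\<lambda>j. v $ (n - Suc j))) \<and> vec n (\<lambda>j. v $ (n - Suc j)) $ j \<noteq> 0 \<and>
     vec n (\<lambda>j. v $ (n - Suc j)) $ k \<noteq> 0 \<and> (\<forall>l. j < l \<and> l < k \<longrightarrow> vec n (\<lambda>j. v $ (n - Suc j)) $ l = 0)"
  have "v $ l = 0" if "n - Suc k < l" "l < n - Suc j" for l
  proof -
    have "j < n - Suc l" "n - Suc l < k" "n - Suc (n - Suc l) = l" "n - Suc l < n" using that * by auto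
    then show ?thesis using * by (metis index_vec)
  qed
  moreover have "n - Suc k < n - Suc j" "n - Suc j < n" using * by auto
  ultimately have "v $ (n - Suc j) = - v $ (n - Suc k)"
    using assms * unfolding asm_line_def alternating_vec_def by auto
  then show "vec n (\<lambda>j. v $ (n - Suc j)) $ k = - vec n (\<lambda>j. v $ (n - Suc j)) $ j"
    using * by simp
next
  show "(\<Sum>j<dim_vec (vec n (\<lambda>j. v $ (n - Suc j))). vec n (\<lambda>j. v $ (n - Suc j)) $ j) = 1"
    using assms sum.nat_diff_reindex[of "\<lambda>j. v $ j" n] by (simp add: asm_line_def)
qed

definition rotate_mat :: "nat \<Rightarrow> int mat \<Rightarrow> int mat" where
  "rotate_mat n M = mat n n (\<lambda>(i, j). M $$ (n - Suc i, n - Suc j))"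

lemma rotate_mat_ASM: "M \<in> ASM n \<Longrightarrow> rotate_mat n M \<in> ASM n"
proof -
  assume M: "M \<in> ASM n"
  then have dim: "dim_row M = n" "dim_col M = n" by (auto simp: ASM_def)
  have row_eq: "row (rotate_mat n M) i = vec n (\<lambda>j. row M (n - Suc i) $ (n - Suc j))" if "i < n" for i
    using that dim by (auto simp: rotate_mat_def)
  have col_eq: "col (rotate_mat n M) i = vec n (\<lambda>j. col M (n - Suc i) $ (n - Suc j))" if "i < n" for i
    using that dim by (auto simp: rotate_mat_def)
  have M_lines: "asm_line (row M (n - Suc i))" "asm_line (col M (n - Suc i))" if "i < n" for i
    using M that by (auto simp: ASM_def)
  have "asm_line (row (rotate_mat n M) i)" if "i < n" for i
    unfolding row_eq[OF that] by (rule asm_line_reverse[OF M_lines(1)[OF that]]) (simp add: dim)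
  moreover have "asm_line (col (rotate_mat n M) i)" if "i < n" for i
    unfolding col_eq[OF that] by (rule asm_line_reverse[OF M_lines(2)[OF that]]) (simp add: dim)
  moreover have "rotate_mat n M $$ (i, j) \<in> {-1, 0, 1}" if "i < n" "j < n" for i j
    using that M by (auto simp: rotate_mat_def ASM_def)
  ultimately show ?thesis by (simp add: ASM_def) (simp add: rotate_mat_def)
qed

lemma rotate_mat_rotate_mat: "M \<in> ASM n \<Longrightarrow> rotate_mat n (rotate_mat n M) = M"
  by (auto simp: rotate_mat_def ASM_def)

text \<open>A half turn swaps the first and last rows and reverses positions; this gives the
  symmetry of the doubly refined function in x and y.\<close>

lemma doubly_refined_count_rotate:
  assumes "i < n" "j < n"
  shows "doubly_refined_count n (n - Suc j) (n - Suc i) = doubly_refined_count n i j"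
  unfolding doubly_refined_count_def
proof (rule bij_betw_same_card)
  show "bij_betw (rotate_mat n) {M \<in> ASM n. M $$ (0, n - Suc j) = 1 \<and> M $$ (n - 1, n - Suc i) = 1}
     {M \<in> ASM n. M $$ (0, i) = 1 \<and> M $$ (n - 1, j) = 1}"
    using assms
    by (intro bij_betwI[where g = "rotate_mat n"])
      (auto simp: rotate_mat_ASM rotate_mat_rotate_mat, auto simp: rotate_mat_def)
qed

lemma asm_count_pos: "asm_count n > 0"
proof -
  have "asm_line (unit_vec n i)" if "i < n" for i
  proof -
    have s: "(\<Sum>j<k. unit_vec n i $ j) = (if i < k then 1 else 0 :: int)" if "k \<le> n" for k
      using that \<open>i < n\<close> by (simp add: unit_vec_def sum.delta cong: sum.cong_simp)
    show ?thesis using s \<open>i < n\<close> by (auto simp: asm_line_iff)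
  qed
  then have "1\<^sub>m n \<in> ASM n" by (auto simp: ASM_def)
  then show ?thesis using finite_ASM[of n] by (auto simp: asm_count_def card_gt_0_iff)
qed

section \<open>Polynomials with staircase exponents\<close>

text \<open>This is S_n. It is chosen by \<open>SOME\<close> because \<open>polynomial_below\<close>
  only asserts existence; its coefficients in x are not the refined counts.\<close>

definition refined_poly :: "nat \<Rightarrow> complex poly" where
  "refined_poly n = (SOME p. (\<forall>x. poly p x = partition_fn (x # replicate (n - 1) 1) (replicate n 1) (replicate n False)) \<and>
     (\<forall>k\<ge>n. coeff p k = 0))"

definition doubly_refined_poly :: "nat \<Rightarrow> complex \<Rightarrow> complex poly" where
  "doubly_refined_poly n y = (SOME p. (\<forall>x. poly p x =
     partition_fn (x # replicate (n - 2) 1 @ [y]) (replicate n 1) (replicate n False)) \<and> (\<forall>k\<ge>n. coeff p k = 0))"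

lemma refined_poly:
  "poly (refined_poly n) x = partition_fn (x # replicate (n - 1) 1) (replicate n 1) (replicate n False)"
  "k \<ge> n \<Longrightarrow> coeff (refined_poly n) k = 0"
proof -
  have "\<exists>p. (\<forall>x. poly p x = partition_fn (x # replicate (n - 1) 1) (replicate n 1) (replicate n False)) \<and>
     (\<forall>k\<ge>n. coeff p k = 0)"
    using polynomial_below_partition_fn[of "replicate n 1" "replicate (n - 1) 1"]
    unfolding polynomial_below_def length_replicate by metis
  from someI_ex[OF this]
  show "poly (refined_poly n) x = partition_fn (x # replicate (n - 1) 1) (replicate n 1) (replicate n False)"
    "k \<ge> n \<Longrightarrow> coeff (refined_poly n) k = 0"
    unfolding refined_poly_def by blast+
qed

lemma doubly_refined_poly:
  "poly (doubly_refined_poly n y) x =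
     partition_fn (x # replicate (n - 2) 1 @ [y]) (replicate n 1) (replicate n False)"
proof -
  have "\<exists>p. (\<forall>x. poly p x = partition_fn (x # replicate (n - 2) 1 @ [y]) (replicate n 1) (replicate n False)) \<and>
     (\<forall>k\<ge>n. coeff p k = 0)"
    using polynomial_below_partition_fn[of "replicate n 1" "replicate (n - 2) 1 @ [y]"]
    unfolding polynomial_below_def length_replicate by metis
  from someI_ex[OF this] show ?thesis
    unfolding doubly_refined_poly_def by blast
qed

lemma weight_a_1_1 [simp]: "weight_a 1 1 = 1" and weight_b_1_1 [simp]: "weight_b 1 1 = 1"
  by (simp_all add: weight_a_def weight_b_def)

lemma prod_list_map_replicate: "(\<Prod>x\<leftarrow>replicate n c. f x) = (f c ^ n :: complex)"
  by (induction n) simp_all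

lemma refined_poly_1:
  assumes "n \<ge> 1"
  shows "poly (refined_poly n) 1 = of_nat (asm_count n)"
proof -
  have "1 # replicate (n - 1) 1 = (replicate n 1 :: complex list)"
    using assms by (cases n) auto
  then show ?thesis unfolding refined_poly using partition_fn_asm_count[of n] by simp
qed

text \<open>At \<omega> the weight \<open>weight_b\<close> vanishes, so the 1 of the first row is in
  the last column. Removing both leaves an arbitrary ASM of size n, and the other n vertices of the
  row give the power of -\<omega>^2.\<close>

lemma refined_poly_omega:
  "poly (refined_poly (Suc n)) \<omega> = (- (\<omega>\<^sup>2)) ^ n * of_nat (asm_count n)"
proof -
  have b: "weight_b \<omega> 1 = 0" and a: "weight_a \<omega> 1 = - (\<omega>\<^sup>2)"
    by (simp_all add: weight_a_def weight_b_def algebra_simps omega_simps)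
  have "replicate (Suc n) (1::complex) = replicate n 1 @ [1]" by (simp add: replicate_append_same)
  then show ?thesis
    unfolding refined_poly
    using partition_fn_freeze_last[OF b, of "replicate n 1" "replicate n 1"] partition_fn_asm_count[of n]
    by (simp add: prod_list_map_replicate a del: partition_fn.simps replicate.simps)
qed

lemma refined_poly_omega_sq:
  "poly (refined_poly (Suc n)) (\<omega>\<^sup>2) = (- \<omega>) ^ n * of_nat (asm_count n)"
proof -
  have a: "weight_a (\<omega>\<^sup>2) 1 = 0" and b: "weight_b (\<omega>\<^sup>2) 1 = - \<omega>"
    by (simp_all add: weight_a_def weight_b_def algebra_simps omega_simps)
  show ?thesis
    unfolding refined_poly
    using partition_fn_freeze_first[OF a, of "replicate n 1" "replicate n 1"] partition_fn_asm_count[of n]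
    by (simp add: prod_list_map_replicate b del: partition_fn.simps)
qed

lemma poly_doubly_refined_poly:
  assumes "n \<ge> 2"
  shows "poly (doubly_refined_poly n y) x = (\<Sum>i<n. \<Sum>j<n. of_nat (doubly_refined_count n i j) *
        ((weight_a x 1 ^ i * weight_b x 1 ^ (n - Suc i)) * (weight_b y 1 ^ j * weight_a y 1 ^ (n - Suc j))))"
proof -
  have "n = Suc (Suc (n - 2))" using assms by simp
  then show ?thesis unfolding doubly_refined_poly by (rule partition_fn_doubly_refined)
qed

lemma sum_reflect:
  fixes g :: "nat \<Rightarrow> nat \<Rightarrow> complex"
  shows "(\<Sum>j<n. \<Sum>i<n. g i j) = (\<Sum>j<n. \<Sum>i<n. g (n - Suc i) (n - Suc j))"
proof -
  have "(\<Sum>i<n. g i j) = (\<Sum>i<n. g (n - Suc i) j)" for j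
    by (rule sum.nat_diff_reindex[symmetric])
  then have "(\<Sum>j<n. \<Sum>i<n. g i j) = (\<Sum>j<n. \<Sum>i<n. g (n - Suc i) j)" by simp
  also have "\<dots> = (\<Sum>j<n. \<Sum>i<n. g (n - Suc i) (n - Suc j))"
    by (rule sum.nat_diff_reindex[symmetric])
  finally show ?thesis .
qed

text \<open>The half turn reverses positions, and the exchanged roles of the two weights in the last
  row undo exactly this reversal.\<close>

lemma doubly_refined_poly_commute:
  assumes "n \<ge> 2"
  shows "poly (doubly_refined_poly n y) x = poly (doubly_refined_poly n x) y"
proof -
  have "poly (doubly_refined_poly n y) x = (\<Sum>j<n. \<Sum>i<n. of_nat (doubly_refined_count n i j) *
        ((weight_a x 1 ^ i * weight_b x 1 ^ (n - Suc i)) * (weight_b y 1 ^ j * weight_a y 1 ^ (n - Suc j))))"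
    unfolding poly_doubly_refined_poly[OF assms] by (rule sum.swap)
  also have "\<dots> = (\<Sum>j<n. \<Sum>i<n. of_nat (doubly_refined_count n (n - Suc i) (n - Suc j)) *
        ((weight_a x 1 ^ (n - Suc i) * weight_b x 1 ^ (n - Suc (n - Suc i))) *
         (weight_b y 1 ^ (n - Suc j) * weight_a y 1 ^ (n - Suc (n - Suc j)))))"
    by (rule sum_reflect)
  also have "\<dots> = (\<Sum>j<n. \<Sum>i<n. of_nat (doubly_refined_count n j i) *
        ((weight_a y 1 ^ j * weight_b y 1 ^ (n - Suc j)) * (weight_b x 1 ^ i * weight_a x 1 ^ (n - Suc i))))"
    by (intro sum.cong refl) (simp add: doubly_refined_count_rotate mult_ac)
  finally show ?thesis unfolding poly_doubly_refined_poly[OF assms] .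
qed

lemma doubly_refined_poly_1: 
  assumes "n \<ge> 2"
  shows "doubly_refined_poly n 1 = refined_poly n"
proof -
  have "replicate (n - 2) 1 @ [1] = (replicate (n - 1) 1 :: complex list)"
    using assms by (metis Suc_1 Suc_diff_Suc Suc_le_eq replicate_Suc replicate_append_same)
  then have "poly (doubly_refined_poly n 1) x = poly (refined_poly n) x" for x
    by (simp only: doubly_refined_poly refined_poly)
  then show ?thesis by (intro poly_eq_poly_eq_iff[THEN iffD1] ext)
qed

definition staircase_poly :: "nat \<Rightarrow> complex poly \<Rightarrow> bool" where
  "staircase_poly n p \<longleftrightarrow> (\<forall>k. k mod 3 = 2 \<or> k \<ge> 3 * n - 1 \<longrightarrow> coeff p k = 0)"

lemma staircase_poly_diff: "staircase_poly n p \<Longrightarrow> staircase_poly n q \<Longrightarrow> staircase_poly n (p - q)"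
  and staircase_poly_smult: "staircase_poly n p \<Longrightarrow> staircase_poly n (smult c p)"
  by (simp_all add: staircase_poly_def)

lemma staircase_poly_mono: "staircase_poly n p \<Longrightarrow> n \<le> m \<Longrightarrow> staircase_poly m p"
proof -
  assume p: "staircase_poly n p" and "n \<le> m"
  then have "k \<ge> 3 * n - 1" if "k \<ge> 3 * m - 1" for k using that by linarith
  then show ?thesis using p unfolding staircase_poly_def by blast
qed

text \<open>Multiplication by x^3 shifts admissible exponents to admissible ones, one block further.
  The factor x^3 - 1 arises as the product of \<open>lin1\<close> and \<open>quad1\<close>.\<close>

lemma staircase_poly_cube:
  assumes "staircase_poly n p" "n \<ge> 1"
  shows "staircase_poly (Suc n) ((monom 1 3 - 1) * p)"
proof -
  have "coeff (monom 1 3 * p) k = 0" if k: "k mod 3 = 2 \<or> k \<ge> 3 * Suc n - 1" for k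
  proof -
    have "k < 3 \<or> (k - 3) mod 3 = 2 \<or> k - 3 \<ge> 3 * n - 1"
      using k by (auto simp: le_mod_geq)
    then show ?thesis using assms by (auto simp: coeff_monom_mult staircase_poly_def)
  qed
  then have "staircase_poly (Suc n) (monom 1 3 * p)" by (simp add: staircase_poly_def)
  then show ?thesis
    using staircase_poly_diff[OF _ staircase_poly_mono[OF assms(1)], of "Suc n" "monom 1 3 * p"]
    by (simp add: algebra_simps)
qed

abbreviation (input) lin1 :: "complex poly" where "lin1 \<equiv> [:- 1, 1:]"
abbreviation (input) quad1 :: "complex poly" where "quad1 \<equiv> [:1, 1, 1:]"

lemma lin1_quad1: "lin1 * quad1 = monom 1 3 - 1"
  by (simp add: monom_altdef numeral_3_eq_3 one_pCons)

lemma coeff_theta: "coeff (pCons 0 (pderiv p)) i = of_nat i * coeff p i"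
  by (cases i) (simp_all add: coeff_pderiv)

lemma dvd_pderiv:
  fixes p :: "complex poly"
  assumes "q ^ Suc m dvd p"
  shows "q ^ m dvd pderiv p"
proof -
  obtain r where "p = q ^ Suc m * r" using assms by blast
  then have "pderiv p = q ^ m * (q * pderiv r + smult (of_nat (Suc m)) (pderiv q) * r)"
    by (simp only: pderiv_mult pderiv_power_Suc) (simp add: algebra_simps)
  then show ?thesis by simp
qed

lemma sparse_poly_root_one:
  fixes p :: "complex poly"
  assumes "card {k. coeff p k \<noteq> 0} \<le> m" "lin1 ^ m dvd p"
  shows "p = 0"
  using assms
proof (induction m arbitrary: p)
  case 0
  have fin: "finite {k. coeff p k \<noteq> 0}" for p :: "complex poly"
    using MOST_coeff_eq_0[of p] by (simp add: eventually_cofinite)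
  then show ?case using 0 by (auto simp: poly_eq_iff)
next
  case (Suc m)
  have fin: "finite {k. coeff p k \<noteq> 0}"
    using MOST_coeff_eq_0[of p] by (simp add: eventually_cofinite)
  show ?case
  proof (rule ccontr)
    assume "p \<noteq> 0"
    then obtain k where k: "coeff p k \<noteq> 0" by (auto simp: poly_eq_iff)
    \<comment> \<open>Apply \<open>x d/dx - k\<close>: this removes one term and lowers the order of vanishing by at most one.\<close>
    define q where "q = pCons 0 (pderiv p) - smult (of_nat k) p"
    have coeff_q: "coeff q i = (of_nat i - of_nat k) * coeff p i" for i
      unfolding q_def by (simp only: coeff_diff coeff_theta coeff_smult) (simp add: algebra_simps)
    have "{i. coeff q i \<noteq> 0} = {i. coeff p i \<noteq> 0} - {k}"
      by (auto simp: coeff_q)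
    then have "card {i. coeff q i \<noteq> 0} \<le> m"
      using Suc.prems(1) k fin by simp
    moreover have "lin1 ^ m dvd q"
    proof -
      have "pCons 0 (pderiv p) = [:0, 1:] * pderiv p" by simp
      moreover have "lin1 ^ m dvd p" using Suc.prems(2) by (metis dvd_mult_right power_Suc)
      ultimately show ?thesis
        unfolding q_def using dvd_pderiv[OF Suc.prems(2)] by (intro dvd_diff dvd_smult) (metis dvd_mult)
    qed
    ultimately have "q = 0" by (rule Suc.IH)
    then have "coeff p i = 0" if "i \<noteq> k" for i
      using coeff_q[of i] that by simp
    then have "p = monom (coeff p k) k" by (auto simp: poly_eq_iff)
    moreover have "poly p 1 = 0"
      using Suc.prems(2) by (metis dvd_trans dvd_power zero_less_Suc poly_eq_0_iff_dvd)
    ultimately show False using k by (metis mult_eq_0_iff poly_monom power_one one_neq_zero)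
  qed
qed

lemma staircase_poly_root_one:
  assumes "staircase_poly n p" "lin1 ^ (2 * n) dvd p"
  shows "p = 0"
proof (rule sparse_poly_root_one)
  have "{k. coeff p k \<noteq> 0} \<subseteq> (\<lambda>j. 3 * j) ` {..<n} \<union> (\<lambda>j. 3 * j + 1) ` {..<n}"
  proof
    fix k assume "k \<in> {k. coeff p k \<noteq> 0}"
    then have "k mod 3 \<noteq> 2" "k < 3 * n - 1" using assms(1) unfolding staircase_poly_def not_le[symmetric] by blast+
    then have "(k = 3 * (k div 3) \<or> k = 3 * (k div 3) + 1) \<and> k div 3 < n" by presburger
    then show "k \<in> (\<lambda>j. 3 * j) ` {..<n} \<union> (\<lambda>j. 3 * j + 1) ` {..<n}" by auto
  qed
  then have "card {k. coeff p k \<noteq> 0} \<le> card ((\<lambda>j. 3 * j) ` {..<n} \<union> (\<lambda>j. 3 * j + 1) ` {..<n})"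
    by (intro card_mono) auto
  also have "\<dots> \<le> card {..<n} + card {..<n}"
    by (intro order_trans[OF card_Un_le] add_mono card_image_le) auto
  finally show "card {k. coeff p k \<noteq> 0} \<le> 2 * n" by simp
qed (rule assms(2))

text \<open>Without the top exponent 3n-2 only 2n-1 exponents remain, so one order of vanishing
  fewer suffices. This determines the degree of S_n.\<close>

lemma staircase_poly_root_one_short:
  assumes "staircase_poly n p" "lin1 ^ (2 * n - 1) dvd p" "coeff p (3 * n - 2) = 0"
  shows "p = 0"
proof (rule sparse_poly_root_one)
  have "{k. coeff p k \<noteq> 0} \<subseteq> (\<lambda>j. 3 * j) ` {..<n} \<union> (\<lambda>j. 3 * j + 1) ` {..<n - 1}"
  proof
    fix k assume k: "k \<in> {k. coeff p k \<noteq> 0}"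
    then have "k mod 3 \<noteq> 2" "k < 3 * n - 1"
      using assms(1) unfolding staircase_poly_def not_le[symmetric] by blast+
    moreover have "k \<noteq> 3 * n - 2" using k assms(3) by auto
    moreover have "k = 3 * (k div 3) + k mod 3" by simp
    moreover have "k mod 3 = 0 \<or> k mod 3 = 1 \<or> k mod 3 = 2" by linarith
    ultimately have "(k = 3 * (k div 3) \<and> k div 3 < n) \<or> (k = 3 * (k div 3) + 1 \<and> k div 3 < n - 1)"
      by linarith
    then show "k \<in> (\<lambda>j. 3 * j) ` {..<n} \<union> (\<lambda>j. 3 * j + 1) ` {..<n - 1}" by auto
  qed
  then have "card {k. coeff p k \<noteq> 0} \<le> card ((\<lambda>j. 3 * j) ` {..<n} \<union> (\<lambda>j. 3 * j + 1) ` {..<n - 1})"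
    by (intro card_mono) auto
  also have "\<dots> \<le> card {..<n} + card {..<n - 1}"
    by (intro order_trans[OF card_Un_le] add_mono card_image_le) auto
  finally show "card {k. coeff p k \<noteq> 0} \<le> 2 * n - 1" by simp
qed (rule assms(2))

text \<open>The exponent 2n-1 collects n-1 other rows and n columns, all with parameter 1.\<close>

lemma staircase_refined_poly:
  assumes "n \<ge> 1"
  shows "staircase_poly n (lin1 ^ (2 * n - 1) * refined_poly n)"
  unfolding staircase_poly_def
proof (intro allI impI)
  fix k assume "k mod 3 = 2 \<or> k \<ge> 3 * n - 1"
  moreover have "poly (lin1 ^ (2 * n - 1) * refined_poly n) x =
      staircase_fn (replicate (n - 1) 1) (replicate n 1) x" for x
  proof -
    have "2 * n - 1 = (n - 1) + n" using assms by simp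
    then have "(x - 1) ^ (2 * n - 1) = (x - 1) ^ (n - 1) * (x - 1) ^ n" by (simp only: power_add)
    then show ?thesis
      by (simp add: staircase_fn_def refined_poly prod_list_map_replicate mult_ac del: partition_fn.simps)
  qed
  ultimately show "coeff (lin1 ^ (2 * n - 1) * refined_poly n) k = 0"
    using assms by (intro coeff_staircase_fn[of n "replicate (n - 1) 1"]) auto
qed

text \<open>The last row has parameter y, so one factor x - 1 is replaced by x - y.\<close>

lemma staircase_doubly_refined_poly:
  assumes "n \<ge> 2"
  shows "staircase_poly n (lin1 ^ (2 * n - 2) * ([:- y, 1:] * doubly_refined_poly n y))"
  unfolding staircase_poly_def
proof (intro allI impI)
  fix k assume "k mod 3 = 2 \<or> k \<ge> 3 * n - 1"
  moreover have "poly (lin1 ^ (2 * n - 2) * ([:- y, 1:] * doubly_refined_poly n y)) x =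
      staircase_fn (replicate (n - 2) 1 @ [y]) (replicate n 1) x" for x
  proof -
    have "2 * n - 2 = (n - 2) + n" using assms by simp
    then have "(x - 1) ^ (2 * n - 2) = (x - 1) ^ (n - 2) * (x - 1) ^ n" by (simp only: power_add)
    then show ?thesis
      by (simp add: staircase_fn_def doubly_refined_poly prod_list_map_replicate mult_ac del: partition_fn.simps)
        (simp add: algebra_simps del: partition_fn.simps)
  qed
  ultimately show "coeff (lin1 ^ (2 * n - 2) * ([:- y, 1:] * doubly_refined_poly n y)) k = 0"
    using assms by (intro coeff_staircase_fn[of n "replicate (n - 2) 1 @ [y]"]) auto
qed

lemma lin1_dvd_iff: "lin1 dvd p \<longleftrightarrow> poly p 1 = 0"
  by (simp add: poly_eq_0_iff_dvd)

text \<open>Both generators satisfy the hypothesis on \<open>g\<close>, the second because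
  (x-1)(x^2+x+1) = x^3 - 1 lifts S_{n-1} by one block. Subtracting suitable multiples of them
  removes two orders at 1, and a staircase polynomial vanishing to order 2n there is 0.\<close>

lemma staircase_span:
  assumes n: "n \<ge> 2" and g: "staircase_poly n (lin1 ^ (2 * n - 2) * g)"
  obtains \<alpha> where "g = smult \<alpha> (lin1 * refined_poly n) +
    smult (poly g 1 / (3 * of_nat (asm_count (n - 1)))) (quad1 * refined_poly (n - 1))"
proof -
  \<comment> \<open>At 1 the first generator vanishes and the second equals 3 A_{n-1}.\<close>
  define \<beta> where "\<beta> = poly g 1 / (3 * of_nat (asm_count (n - 1)))"
  have A: "of_nat (asm_count k) \<noteq> (0::complex)" for k
    using asm_count_pos[of k] by simp
  have "poly (g - smult \<beta> (quad1 * refined_poly (n - 1))) 1 = 0"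
    using n A[of "n - 1"] by (simp add: \<beta>_def refined_poly_1)
  then obtain q where q: "g - smult \<beta> (quad1 * refined_poly (n - 1)) = lin1 * q"
    unfolding lin1_dvd_iff[symmetric] by blast
  \<comment> \<open>After division by x - 1 the first generator becomes S_n, with value A_n at
    1.\<close>
  define \<alpha> where "\<alpha> = poly q 1 / of_nat (asm_count n)"
  have "poly (q - smult \<alpha> (refined_poly n)) 1 = 0"
    using n A[of n] by (simp add: \<alpha>_def refined_poly_1)
  then obtain r where r: "q - smult \<alpha> (refined_poly n) = lin1 * r"
    unfolding lin1_dvd_iff[symmetric] by blast
  have g_eq: "g - smult \<beta> (quad1 * refined_poly (n - 1)) - smult \<alpha> (lin1 * refined_poly n) = lin1 ^ 2 * r"
    unfolding q power2_eq_square mult.assoc r[symmetric] right_diff_distrib by (simp only: mult_smult_right)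
  have e1: "lin1 ^ (2 * n - 2) * (quad1 * refined_poly (n - 1)) =
      (monom 1 3 - 1) * (lin1 ^ (2 * (n - 1) - 1) * refined_poly (n - 1))"
  proof -
    have "2 * n - 2 = Suc (2 * (n - 1) - 1)" using n by simp
    then have "lin1 ^ (2 * n - 2) = lin1 * lin1 ^ (2 * (n - 1) - 1)" by (simp only: power_Suc)
    then show ?thesis unfolding lin1_quad1[symmetric] by (simp only: mult_ac)
  qed
  have e2: "lin1 ^ (2 * n - 2) * (lin1 * refined_poly n) = lin1 ^ (2 * n - 1) * refined_poly n"
  proof -
    have "2 * n - 1 = Suc (2 * n - 2)" using n by simp
    then have "lin1 ^ (2 * n - 1) = lin1 * lin1 ^ (2 * n - 2)" by (simp only: power_Suc)
    then show ?thesis by (simp only: mult_ac)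
  qed
  have "staircase_poly n ((monom 1 3 - 1) * (lin1 ^ (2 * (n - 1) - 1) * refined_poly (n - 1)))"
    using staircase_poly_cube[OF staircase_refined_poly[of "n - 1"]] n by simp
  then have "staircase_poly n (lin1 ^ (2 * n - 2) * g -
      smult \<beta> (lin1 ^ (2 * n - 2) * (quad1 * refined_poly (n - 1))) -
      smult \<alpha> (lin1 ^ (2 * n - 2) * (lin1 * refined_poly n)))"
    unfolding e1 e2 using g staircase_refined_poly[of n] n
    by (intro staircase_poly_diff staircase_poly_smult) simp_all
  also have "lin1 ^ (2 * n - 2) * g -
      smult \<beta> (lin1 ^ (2 * n - 2) * (quad1 * refined_poly (n - 1))) -
      smult \<alpha> (lin1 ^ (2 * n - 2) * (lin1 * refined_poly n)) = lin1 ^ (2 * n - 2) * (lin1 ^ 2 * r)"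
    unfolding g_eq[symmetric] right_diff_distrib by (simp only: mult_smult_right)
  also have "\<dots> = lin1 ^ (2 * n) * r"
  proof -
    have "2 * n = (2 * n - 2) + 2" using n by simp
    then have "lin1 ^ (2 * n) = lin1 ^ (2 * n - 2) * lin1 ^ 2" by (metis power_add)
    then show ?thesis by (simp only: mult.assoc)
  qed
  finally have "lin1 ^ (2 * n) * r = 0"
    by (rule staircase_poly_root_one) simp
  then have "r = 0" by simp
  then have "g = smult \<alpha> (lin1 * refined_poly n) + smult \<beta> (quad1 * refined_poly (n - 1))"
    using g_eq by (simp add: algebra_simps)
  then show thesis using that unfolding \<beta>_def by blast
qed

section \<open>The Bezoutian formula and the recurrence\<close>

abbreviation asm_number :: "nat \<Rightarrow> complex" where "asm_number n \<equiv> of_nat (asm_count n)"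

lemma asm_number_nonzero: "asm_number n \<noteq> 0"
  using asm_count_pos[of n] by simp

definition phi :: "nat \<Rightarrow> complex \<Rightarrow> complex" where
  "phi n x = (x - 1) * poly (refined_poly n) x"

definition psi :: "nat \<Rightarrow> complex \<Rightarrow> complex" where
  "psi n x = (x\<^sup>2 + x + 1) * poly (refined_poly (n - 1)) x"

lemma poly_quad1: "poly quad1 x = x\<^sup>2 + x + 1"
  by (simp add: power2_eq_square algebra_simps)

lemma refined_poly_nonzero: "n \<ge> 1 \<Longrightarrow> refined_poly n \<noteq> 0"
  using refined_poly_1[of n] asm_number_nonzero[of n] by auto

text \<open>For fixed y the product (x - y) P lies in the span of \<open>phi n\<close> and
  \<open>psi n\<close>. Evaluation at x = 1, where P is S_n(y), gives the coefficient of
  \<open>psi n\<close>; that of \<open>phi n\<close> is found from antisymmetry.\<close>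

lemma doubly_refined_bezoutian:
  assumes n: "n \<ge> 2"
  shows "3 * asm_number (n - 1) * (x - y) * poly (doubly_refined_poly n y) x = phi n x * psi n y - phi n y * psi n x"
proof -
  define P where "P = (\<lambda>x y. poly (doubly_refined_poly n y) x)"
  have P_sym: "P x y = P y x" for x y
    unfolding P_def by (rule doubly_refined_poly_commute[OF n])
  have P_1: "P 1 y = poly (refined_poly n) y" for y
    unfolding P_sym[of 1 y] by (simp add: P_def doubly_refined_poly_1[OF n])
  have "\<exists>\<alpha>. \<forall>x. 3 * asm_number (n - 1) * ((x - y) * P x y) = \<alpha> * phi n x - phi n y * psi n x" for y
  proof -
    obtain \<alpha> where eq: "[:- y, 1:] * doubly_refined_poly n y = smult \<alpha> (lin1 * refined_poly n) +
      smult (poly ([:- y, 1:] * doubly_refined_poly n y) 1 / (3 * asm_number (n - 1))) (quad1 * refined_poly (n - 1))"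
      using staircase_span[OF n staircase_doubly_refined_poly[OF n]] by metis
    have "(x - y) * P x y = \<alpha> * phi n x + (1 - y) * P 1 y / (3 * asm_number (n - 1)) * psi n x" for x
    proof -
      have lin: "poly [:- y, 1:] x = x - y" "poly lin1 x = x - 1" for x by simp_all
      have "(x - y) * P x y = poly ([:- y, 1:] * doubly_refined_poly n y) x"
        by (simp only: P_def poly_mult lin)
      also have "\<dots> = \<alpha> * phi n x + (1 - y) * P 1 y / (3 * asm_number (n - 1)) * psi n x"
        by (subst eq) (simp only: poly_add poly_smult poly_mult poly_quad1 phi_def psi_def P_def lin)
      finally show ?thesis .
    qed
    then have "3 * asm_number (n - 1) * ((x - y) * P x y) = 3 * asm_number (n - 1) * \<alpha> * phi n x - phi n y * psi n x" for x
      unfolding P_1 using asm_number_nonzero[of "n - 1"] by (simp add: phi_def field_simps)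
    then show ?thesis by blast
  qed
  then obtain \<alpha> where \<alpha>: "\<And>x y. 3 * asm_number (n - 1) * ((x - y) * P x y) = \<alpha> y * phi n x - phi n y * psi n x"
    by metis
  \<comment> \<open>\<open>\<gamma>\<close> is the deviation from the Bezoutian. Antisymmetry makes
    it vanish first at a point \<open>x0\<close> where \<open>phi n\<close> does not vanish, then
    everywhere.\<close>
  define \<gamma> where "\<gamma> = (\<lambda>y. \<alpha> y - psi n y)"
  have \<gamma>: "\<gamma> y * phi n x + \<gamma> x * phi n y = 0" for x y
  proof -
    have "3 * asm_number (n - 1) * ((x - y) * P x y) + 3 * asm_number (n - 1) * ((y - x) * P y x) = 0"
      unfolding P_sym[of y x] by (simp add: algebra_simps)
    then show ?thesis unfolding \<alpha> \<gamma>_def by (simp add: algebra_simps)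
  qed
  have "\<exists>x0. phi n x0 \<noteq> 0"
  proof (rule ccontr)
    assume "\<nexists>x0. phi n x0 \<noteq> 0"
    then have "poly (lin1 * refined_poly n) x = 0" for x
      by (auto simp: phi_def)
    then have "lin1 * refined_poly n = 0" using poly_all_0_iff_0 by blast
    then show False using refined_poly_nonzero[of n] n unfolding mult_eq_0_iff by simp
  qed
  then obtain x0 where x0: "phi n x0 \<noteq> 0" by blast
  have "\<gamma> x0 = 0" using \<gamma>[of x0 x0] x0 by simp
  then have "\<gamma> y = 0" for y using \<gamma>[of y x0] x0 by simp
  then have "\<alpha> = psi n" by (auto simp: \<gamma>_def)
  then show ?thesis using \<alpha>[of x y] by (simp add: P_def mult_ac)
qed

lemma poly_quad1_omega: "poly quad1 \<omega> = 0" and poly_quad1_omega_sq: "poly quad1 (\<omega>\<^sup>2) = 0"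
  by (simp_all add: algebra_simps omega_simps)

lemma quad1_factor: "x\<^sup>2 + x + 1 = (\<omega> - x) * (\<omega>\<^sup>2 - x)"
  by (simp add: algebra_simps omega_simps power2_eq_square[of x])

text \<open>The left-hand side minus a multiple of \<open>S\<^sub>n\<close> vanishes at 1, and its quotient by \<open>x - 1\<close> lies in the
  span for \<open>n + 1\<close>; the coefficient of \<open>S\<^sub>n\<^sub>+\<^sub>1\<close> is found at \<open>x = \<omega>\<close>.\<close>

lemma refined_poly_recurrence:
  assumes n: "n \<ge> 2"
  obtains M where "quad1\<^sup>2 * refined_poly (n - 1) =
    smult (- 3 * (asm_number (n - 1))\<^sup>2 / (asm_number n)\<^sup>2) (lin1\<^sup>2 * refined_poly (Suc n)) + M * refined_poly n"
proof -
  \<comment> \<open>At 1 the square of \<open>quad1\<close> is 9, so this multiple of S_n makes the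
    difference vanish there.\<close>
  define \<kappa> where "\<kappa> = 9 * asm_number (n - 1) / asm_number n"
  have "poly (quad1\<^sup>2 * refined_poly (n - 1) - smult \<kappa> (refined_poly n)) 1 = 0"
    using n asm_number_nonzero[of n] by (simp add: \<kappa>_def refined_poly_1 poly_power)
  then obtain g where g: "quad1\<^sup>2 * refined_poly (n - 1) - smult \<kappa> (refined_poly n) = lin1 * g"
    unfolding lin1_dvd_iff[symmetric] by blast
  have "staircase_poly (Suc n) (lin1 ^ (2 * Suc n - 2) * g)"
  proof -
    have e1: "2 * Suc n - 2 = Suc (2 * n - 1)" "2 * n - 1 = Suc (Suc (2 * (n - 1) - 1))" using n by simp_all
    have "lin1 ^ (2 * Suc n - 2) * g = lin1 ^ (2 * n - 1) * (lin1 * g)"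
      unfolding e1(1) power_Suc by (simp only: mult_ac)
    also have "\<dots> = lin1 ^ (2 * n - 1) * (quad1\<^sup>2 * refined_poly (n - 1)) -
        smult \<kappa> (lin1 ^ (2 * n - 1) * refined_poly n)"
      unfolding g[symmetric] right_diff_distrib by (simp only: mult_smult_right)
    \<comment> \<open>Two factors \<open>quad1\<close> pair with two factors x - 1 to give (x^3 -
      1)^2, which lifts S_{n-1} by two blocks.\<close>
    also have "lin1 ^ (2 * n - 1) * (quad1\<^sup>2 * refined_poly (n - 1)) =
        (lin1 * quad1) * ((lin1 * quad1) * (lin1 ^ (2 * (n - 1) - 1) * refined_poly (n - 1)))"
      unfolding e1(2) power_Suc power2_eq_square by (simp only: mult_ac)
    finally have eq: "lin1 ^ (2 * Suc n - 2) * g =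
      (monom 1 3 - 1) * ((monom 1 3 - 1) * (lin1 ^ (2 * (n - 1) - 1) * refined_poly (n - 1))) -
      smult \<kappa> (lin1 ^ (2 * n - 1) * refined_poly n)"
      unfolding lin1_quad1 .
    have "staircase_poly n ((monom 1 3 - 1) * (lin1 ^ (2 * (n - 1) - 1) * refined_poly (n - 1)))"
      using staircase_poly_cube[OF staircase_refined_poly[of "n - 1"]] n by simp
    then show ?thesis
      unfolding eq using n staircase_refined_poly[of n]
      by (intro staircase_poly_diff staircase_poly_smult staircase_poly_cube)
        (auto intro: staircase_poly_mono)
  qed
  then obtain \<alpha> where "g = smult \<alpha> (lin1 * refined_poly (Suc n)) +
    smult (poly g 1 / (3 * asm_number (Suc n - 1))) (quad1 * refined_poly (Suc n - 1))"
    using staircase_span[of "Suc n" g] n by (metis le_SucI)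
  then obtain \<beta> where g_eq: "g = smult \<alpha> (lin1 * refined_poly (Suc n)) + smult \<beta> (quad1 * refined_poly n)"
    by (metis diff_Suc_1)
  have eq: "quad1\<^sup>2 * refined_poly (n - 1) =
    smult \<alpha> (lin1\<^sup>2 * refined_poly (Suc n)) + ([:\<kappa>:] + smult \<beta> (lin1 * quad1)) * refined_poly n"
  proof -
    have "quad1\<^sup>2 * refined_poly (n - 1) = lin1 * g + smult \<kappa> (refined_poly n)"
      using g by (metis diff_add_cancel)
    also have "\<dots> = smult \<alpha> (lin1 * lin1 * refined_poly (Suc n)) +
        (smult \<kappa> (refined_poly n) + smult \<beta> (lin1 * quad1 * refined_poly n))"
      unfolding g_eq distrib_left mult_smult_right by (simp only: mult.assoc add_ac)
    also have "smult \<kappa> (refined_poly n) + smult \<beta> (lin1 * quad1 * refined_poly n) =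
        ([:\<kappa>:] + smult \<beta> (lin1 * quad1)) * refined_poly n"
      by (simp only: distrib_right mult_smult_left) simp
    finally show ?thesis by (simp only: power2_eq_square)
  qed
  obtain m where m: "n = Suc m" using n by (cases n) auto
  have "poly (quad1\<^sup>2 * refined_poly (n - 1)) \<omega> =
    poly (smult \<alpha> (lin1\<^sup>2 * refined_poly (Suc n)) + ([:\<kappa>:] + smult \<beta> (lin1 * quad1)) * refined_poly n) \<omega>"
    unfolding eq ..
  then have "0 = \<alpha> * ((\<omega> - 1)\<^sup>2 * poly (refined_poly (Suc n)) \<omega>) + \<kappa> * poly (refined_poly n) \<omega>"
    unfolding poly_add poly_mult poly_smult poly_power poly_quad1_omega by simp
  then have "0 = (- (\<omega>\<^sup>2)) ^ m * (\<alpha> * ((\<omega> - 1)\<^sup>2 * (- (\<omega>\<^sup>2))) * asm_number n + \<kappa> * asm_number m)"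
    unfolding m refined_poly_omega power_Suc by (simp add: algebra_simps)
  moreover have "\<omega> \<noteq> 0" using omega_cubed by auto
  ultimately have zero: "\<alpha> * ((\<omega> - 1)\<^sup>2 * (- (\<omega>\<^sup>2))) * asm_number n + \<kappa> * asm_number m = 0" by simp
  \<comment> \<open>The 9 in \<open>\<kappa>\<close> divided by this 3 is the source of the constant
    -3 in the recurrence.\<close>
  have three: "(\<omega> - 1)\<^sup>2 * (- (\<omega>\<^sup>2)) = 3"
    by (simp add: power2_eq_square algebra_simps omega_simps)
  have "3 * \<alpha> * asm_number n = - \<kappa> * asm_number m" 
    using zero unfolding three by (simp add: eq_neg_iff_add_eq_0 mult_ac)
  then have "\<alpha> = - 3 * (asm_number (n - 1))\<^sup>2 / (asm_number n)\<^sup>2"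
    using asm_number_nonzero[of n] by (simp add: \<kappa>_def m field_simps power2_eq_square)
  then show thesis using that eq by blast
qed

lemma asm_count_0: "asm_count 0 = 1"
  using partition_fn_asm_count[of 0] by simp

lemma refined_poly_Suc_0: "refined_poly (Suc 0) = 1"
proof -
  have "coeff (refined_poly (Suc 0)) k = 0" if "k > 0" for k
    using refined_poly(2)[of "Suc 0" k] that by simp
  then have c: "refined_poly (Suc 0) = [:coeff (refined_poly (Suc 0)) 0:]"
    by (auto simp: poly_eq_iff coeff_pCons split: nat.splits)
  have "poly (refined_poly (Suc 0)) \<omega> = 1"
    using refined_poly_omega[of 0] by (simp add: asm_count_0)
  then have "coeff (refined_poly (Suc 0)) 0 = 1" by (subst (asm) c) simp
  then show ?thesis using c by (simp add: one_pCons)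
qed

lemma asm_count_1: "asm_count (Suc 0) = 1"
  using refined_poly_1[of "Suc 0"] by (simp add: refined_poly_Suc_0)

section \<open>Roots of the refined polynomials\<close>

lemma refined_poly_root_neq:
  assumes "poly (refined_poly (Suc n)) r = 0"
  shows "r \<noteq> 1" "r\<^sup>2 + r + 1 \<noteq> 0"
proof -
  have "\<omega> \<noteq> 0" using omega_cubed by auto
  then have "poly (refined_poly (Suc n)) \<omega> \<noteq> 0" "poly (refined_poly (Suc n)) (\<omega>\<^sup>2) \<noteq> 0"
    by (simp_all add: refined_poly_omega refined_poly_omega_sq asm_number_nonzero asm_count_pos)
  then have "r \<noteq> \<omega>" "r \<noteq> \<omega>\<^sup>2" using assms by auto
  then show "r\<^sup>2 + r + 1 \<noteq> 0" by (simp add: quad1_factor)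
  show "r \<noteq> 1" using assms refined_poly_1[of "Suc n"] asm_number_nonzero[of "Suc n"] by auto
qed

text \<open>At a common root of two consecutive polynomials the recurrence makes the preceding one
  vanish as well, as \<open>quad1\<close> is nonzero there; the descent ends at S_1 = 1.\<close>

lemma refined_poly_coprime:
  "poly (refined_poly (Suc (Suc n))) r = 0 \<Longrightarrow> poly (refined_poly (Suc n)) r \<noteq> 0"
proof (induction n)
  case 0
  then show ?case by (simp add: refined_poly_Suc_0)
next
  case (Suc n)
  show ?case
  proof
    assume 0: "poly (refined_poly (Suc (Suc n))) r = 0"
    obtain M where "quad1\<^sup>2 * refined_poly (Suc (Suc n) - 1) =
      smult (- 3 * (asm_number (Suc (Suc n) - 1))\<^sup>2 / (asm_number (Suc (Suc n)))\<^sup>2) (lin1\<^sup>2 * refined_poly (Suc (Suc (Suc n)))) +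
      M * refined_poly (Suc (Suc n))"
      by (rule refined_poly_recurrence[of "Suc (Suc n)"]) auto
    then have "poly (quad1\<^sup>2 * refined_poly (Suc n)) r = 0"
      using 0 Suc.prems by simp
    then have "(r\<^sup>2 + r + 1)\<^sup>2 * poly (refined_poly (Suc n)) r = 0"
      unfolding poly_mult poly_power poly_quad1 .
    then show False
      using Suc.IH[OF 0] refined_poly_root_neq(2)[OF 0] by simp
  qed
qed

lemma degree_refined_poly:
  assumes "n \<ge> 1"
  shows "degree (refined_poly n) = n - 1"
proof (rule ccontr)
  assume "degree (refined_poly n) \<noteq> n - 1"
  moreover have "degree (refined_poly n) \<le> n - 1"
    using refined_poly(2)[of n] assms by (intro degree_le) auto
  ultimately have "degree (refined_poly n) < n - 1" by simp
  then have "degree (lin1 ^ (2 * n - 1) * refined_poly n) < 3 * n - 2"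
    using refined_poly_nonzero[OF assms] by (simp add: degree_mult_eq degree_power_eq)
  then have "coeff (lin1 ^ (2 * n - 1) * refined_poly n) (3 * n - 2) = 0"
    by (rule coeff_eq_0)
  then have "lin1 ^ (2 * n - 1) * refined_poly n = 0"
    using staircase_refined_poly[OF assms] by (intro staircase_poly_root_one_short[of n]) auto
  then show False using refined_poly_nonzero[OF assms] by simp
qed

text \<open>Simplicity provides n distinct zeros of (x - 1) S_n, as many evaluation points as the
  matrix has rows.\<close>

lemma refined_poly_simple_root:
  assumes "n \<ge> 2" and r: "poly (refined_poly n) r = 0"
  shows "poly (pderiv (refined_poly n)) r \<noteq> 0"
proof
  assume r': "poly (pderiv (refined_poly n)) r = 0"
  obtain m where "n = 2 + m" using le_Suc_ex[OF assms(1)] by blast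
  then have m: "n = Suc (Suc m)" by simp
  \<comment> \<open>The operator \<open>x d/dx\<close> preserves the exponents, so its value on \<open>(x - 1)\<^sup>2\<^sup>n\<^sup>-\<^sup>1 S\<^sub>n\<close> is in the span;
    a double root would be a common root of consecutive polynomials.\<close>
  define g where "g = [:0, 1:] * (smult (of_nat (2 * n - 1)) (refined_poly n) + lin1 * pderiv (refined_poly n))"
  have "staircase_poly n (lin1 ^ (2 * n - 2) * g)"
  proof -
    have "pderiv (lin1 ^ Suc (2 * n - 2) * refined_poly n) =
       lin1 ^ (2 * n - 2) * (smult (of_nat (Suc (2 * n - 2))) (refined_poly n) + lin1 * pderiv (refined_poly n))"
      unfolding pderiv_mult pderiv_power_Suc by (simp add: pderiv_pCons algebra_simps)
    moreover have "Suc (2 * n - 2) = 2 * n - 1" using assms(1) by simp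
    ultimately have d: "pderiv (lin1 ^ (2 * n - 1) * refined_poly n) =
       lin1 ^ (2 * n - 2) * (smult (of_nat (2 * n - 1)) (refined_poly n) + lin1 * pderiv (refined_poly n))"
      by (simp only:)
    have "pCons 0 (pderiv (lin1 ^ (2 * n - 1) * refined_poly n)) =
      [:0, 1:] * pderiv (lin1 ^ (2 * n - 1) * refined_poly n)" by simp
    also have "\<dots> = lin1 ^ (2 * n - 2) * g"
      unfolding d g_def by (simp only: mult_ac)
    finally have eq: "pCons 0 (pderiv (lin1 ^ (2 * n - 1) * refined_poly n)) = lin1 ^ (2 * n - 2) * g" .
    show ?thesis
      using staircase_refined_poly[of n] assms(1)
      unfolding eq[symmetric] staircase_poly_def coeff_theta by simp
  qed
  then obtain \<alpha> where "g = smult \<alpha> (lin1 * refined_poly n) +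
    smult (poly g 1 / (3 * asm_number (n - 1))) (quad1 * refined_poly (n - 1))"
    using staircase_span[OF assms(1)] by blast
  then have "poly g r = poly (smult \<alpha> (lin1 * refined_poly n) +
    smult (poly g 1 / (3 * asm_number (n - 1))) (quad1 * refined_poly (n - 1))) r" by simp
  moreover have "poly g r = 0" using r r' by (simp add: g_def)
  ultimately have "poly g 1 / (3 * asm_number (n - 1)) * ((r\<^sup>2 + r + 1) * poly (refined_poly (n - 1)) r) = 0"
    unfolding poly_add poly_smult poly_mult poly_quad1 using r by simp
  \<comment> \<open>A nonzero coefficient of the second generator is what transfers the root to
    S_{n-1}.\<close>
  moreover have "poly g 1 \<noteq> 0"
  proof -
    have "poly g 1 = of_nat (2 * n - 1) * asm_number n"
      using assms(1) by (simp add: g_def refined_poly_1)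
    moreover have "2 * n - 1 \<noteq> 0" using assms(1) by simp
    ultimately show ?thesis using asm_number_nonzero[of n] by (metis mult_eq_0_iff of_nat_eq_0_iff)
  qed
  ultimately have "poly (refined_poly (n - 1)) r = 0"
    using refined_poly_root_neq(2)[of "Suc m" r] r asm_number_nonzero[of "n - 1"] m by simp
  then show False using refined_poly_coprime[of m r] r m by simp
qed

definition refined_roots :: "nat \<Rightarrow> complex set" where
  "refined_roots n = {r. poly (refined_poly n) r = 0}"

definition refined_lead :: "nat \<Rightarrow> complex" where
  "refined_lead n = lead_coeff (refined_poly n)"

lemma refined_poly_factorized:
  assumes "n \<ge> 2"
  shows "refined_poly n = smult (refined_lead n) (\<Prod>r\<in>refined_roots n. [:- r, 1:])"
proof -
  have "rsquarefree (refined_poly n)"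
    using refined_poly_simple_root[OF assms] by (auto simp: rsquarefree_roots)
  from complex_poly_decompose_rsquarefree[OF this] show ?thesis
    by (simp add: refined_roots_def refined_lead_def)
qed

lemma finite_refined_roots: "n \<ge> 1 \<Longrightarrow> finite (refined_roots n)"
  unfolding refined_roots_def using refined_poly_nonzero by (intro poly_roots_finite)

lemma refined_lead_nonzero: "n \<ge> 1 \<Longrightarrow> refined_lead n \<noteq> 0"
  unfolding refined_lead_def using refined_poly_nonzero by simp

lemma card_refined_roots:
  assumes "n \<ge> 2"
  shows "card (refined_roots n) = n - 1"
proof -
  have "n - 1 = degree (smult (refined_lead n) (\<Prod>r\<in>refined_roots n. [:- r, 1:]))"
    using degree_refined_poly[of n] assms refined_poly_factorized[OF assms] by simp
  also have "\<dots> = card (refined_roots n)"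
    using refined_lead_nonzero[of n] assms by (simp add: degree_prod_sum_eq)
  finally show ?thesis ..
qed

lemma poly_refined_poly:
  assumes "n \<ge> 2"
  shows "poly (refined_poly n) x = refined_lead n * (\<Prod>r\<in>refined_roots n. x - r)"
  by (subst refined_poly_factorized[OF assms]) (simp add: poly_prod)

section \<open>The resultant and the determinant\<close>

text \<open>The resultant of S_n and S_{n-1}; the exponent n - 2 is the degree of S_{n-1}.\<close>

definition resultant_value :: "nat \<Rightarrow> complex" where
  "resultant_value n = refined_lead n ^ (n - 2) * (\<Prod>r\<in>refined_roots n. poly (refined_poly (n - 1)) r)"

text \<open>Reciprocity of the resultant; the usual sign is (-1)^(n(n-1)) = 1.\<close>

lemma prod_roots_swap:
  assumes n: "n \<ge> 2"
  shows "refined_lead (Suc n) ^ (n - 1) * (\<Prod>s\<in>refined_roots (Suc n). poly (refined_poly n) s) =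
     refined_lead n ^ n * (\<Prod>r\<in>refined_roots n. poly (refined_poly (Suc n)) r)"
proof -
  let ?R = "refined_roots n" and ?S = "refined_roots (Suc n)"
  have card: "card ?R = n - 1" "card ?S = n"
    using card_refined_roots[of n] card_refined_roots[of "Suc n"] n by simp_all
  have "(\<Prod>s\<in>?S. poly (refined_poly n) s) = refined_lead n ^ n * (\<Prod>s\<in>?S. \<Prod>r\<in>?R. s - r)"
    by (simp add: poly_refined_poly[OF n] prod.distrib card)
  moreover have "(\<Prod>r\<in>?R. poly (refined_poly (Suc n)) r) =
      refined_lead (Suc n) ^ (n - 1) * (\<Prod>r\<in>?R. \<Prod>s\<in>?S. r - s)"
    using n by (simp add: poly_refined_poly prod.distrib card)
  moreover have "(\<Prod>r\<in>?R. \<Prod>s\<in>?S. r - s) = (\<Prod>s\<in>?S. \<Prod>r\<in>?R. s - r)"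
  proof -
    have "(\<Prod>r\<in>?R. \<Prod>s\<in>?S. r - s) = (\<Prod>s\<in>?S. \<Prod>r\<in>?R. - 1 * (s - r))"
      by (subst prod.swap) simp
    also have "\<dots> = ((- 1) ^ (n - 1)) ^ n * (\<Prod>s\<in>?S. \<Prod>r\<in>?R. s - r)"
      by (simp only: prod.distrib prod_constant card)
    also have "((- 1) ^ (n - 1)) ^ n = (1 :: complex)"
    proof -
      have "even ((n - 1) * n)" by (cases n) auto
      then show ?thesis by (simp flip: power_mult)
    qed
    finally show ?thesis by simp
  qed
  ultimately show ?thesis by simp
qed

text \<open>Factoring x^2+x+1 over \<omega> and \<omega>^2 turns the product into S_n(\<omega>)
  S_n(\<omega>^2), where the units cancel.\<close>

lemma prod_quad_refined_roots:
  assumes "n \<ge> 2"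
  shows "(refined_lead n)\<^sup>2 * (\<Prod>r\<in>refined_roots n. r\<^sup>2 + r + 1) = (asm_number (n - 1))\<^sup>2"
proof -
  obtain m where m: "n = Suc m" using assms by (cases n) auto
  have "(refined_lead n)\<^sup>2 * (\<Prod>r\<in>refined_roots n. r\<^sup>2 + r + 1) =
      poly (refined_poly n) \<omega> * poly (refined_poly n) (\<omega>\<^sup>2)"
    unfolding quad1_factor prod.distrib poly_refined_poly[OF assms] power2_eq_square[of "refined_lead n"]
    by (simp only: mult_ac)
  also have "\<dots> = ((- (\<omega>\<^sup>2)) * (- \<omega>)) ^ m * (asm_number m)\<^sup>2"
    unfolding m refined_poly_omega refined_poly_omega_sq power_mult_distrib power2_eq_square[of "asm_number m"]
    by (simp only: mult_ac)
  also have "(- (\<omega>\<^sup>2)) * (- \<omega>) = 1"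
    using omega_cubed by (simp add: power2_eq_square power3_eq_cube)
  finally show ?thesis by (simp add: m)
qed

text \<open>The recurrence is multiplied over all roots of S_n, where the unspecified multiple of
  S_n drops out.\<close>

lemma resultant_value_step:
  assumes n: "n \<ge> 2"
  shows "resultant_value (Suc n) * (- 3 * (asm_number (n - 1))\<^sup>2 / (asm_number n)\<^sup>2) ^ (n - 1) * (asm_number n)\<^sup>2 =
     resultant_value n * (asm_number (n - 1)) ^ 4"
proof -
  let ?R = "refined_roots n" and ?l = "refined_lead n"
  let ?a = "- 3 * (asm_number (n - 1))\<^sup>2 / (asm_number n)\<^sup>2"
  define E where "E = (\<Prod>r\<in>?R. poly (refined_poly (n - 1)) r)"
  define E' where "E' = (\<Prod>r\<in>?R. poly (refined_poly (Suc n)) r)"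
  define Q where "Q = (\<Prod>r\<in>?R. r\<^sup>2 + r + 1)"
  define U where "U = (\<Prod>r\<in>?R. 1 - r)"
  obtain M where M: "quad1\<^sup>2 * refined_poly (n - 1) =
    smult ?a (lin1\<^sup>2 * refined_poly (Suc n)) + M * refined_poly n"
    by (rule refined_poly_recurrence[OF n])
  have "(r\<^sup>2 + r + 1)\<^sup>2 * poly (refined_poly (n - 1)) r = ?a * ((1 - r)\<^sup>2 * poly (refined_poly (Suc n)) r)"
    if "r \<in> ?R" for r
  proof -
    have r0: "poly (refined_poly n) r = 0" using that by (simp add: refined_roots_def)
    have lin: "poly lin1 r = - (1 - r)" by simp
    have "poly (quad1\<^sup>2 * refined_poly (n - 1)) r =
      poly (smult ?a (lin1\<^sup>2 * refined_poly (Suc n)) + M * refined_poly n) r"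
      unfolding M ..
    then show ?thesis
      unfolding poly_add poly_mult poly_smult poly_power poly_quad1 lin power2_minus by (simp add: r0)
  qed
  then have "(\<Prod>r\<in>?R. (r\<^sup>2 + r + 1)\<^sup>2 * poly (refined_poly (n - 1)) r) =
     (\<Prod>r\<in>?R. ?a * ((1 - r)\<^sup>2 * poly (refined_poly (Suc n)) r))"
    by (rule prod.cong[OF refl])
  then have 1: "Q\<^sup>2 * E = ?a ^ (n - 1) * (U\<^sup>2 * E')"
    by (simp only: prod.distrib prod_power_distrib[symmetric] prod_constant card_refined_roots[OF n] Q_def E_def U_def E'_def)
  have 2: "?l\<^sup>2 * Q = (asm_number (n - 1))\<^sup>2"
    unfolding Q_def by (rule prod_quad_refined_roots[OF n])
  have 3: "?l * U = asm_number n"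
    using poly_refined_poly[OF n, of 1] refined_poly_1[of n] n by (simp add: U_def)
  have 4: "resultant_value (Suc n) = ?l ^ n * E'"
    using prod_roots_swap[OF n] by (simp add: resultant_value_def E'_def)
  \<comment> \<open>The leading coefficient is unknown. An extra factor \<open>?l ^ 2\<close>,
    cancelled at the end, groups the remaining powers into the resultants and into
    \<open>?l * U\<close> and \<open>?l\<^sup>2 * Q\<close>, which are known.\<close>
  have "?l ^ n = ?l ^ (n - 2) * ?l\<^sup>2"
    using n by (metis le_add_diff_inverse2 power_add)
  then have "?l ^ 2 * (resultant_value (Suc n) * ?a ^ (n - 1) * (asm_number n)\<^sup>2) =
      ?l ^ 2 * (?l ^ (n - 2) * ?l\<^sup>2 * E' * ?a ^ (n - 1) * (?l * U)\<^sup>2)"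
    unfolding 3[symmetric] 4 by simp
  also have "\<dots> = ?l ^ (n - 2) * ?l ^ 6 * (?a ^ (n - 1) * (U\<^sup>2 * E'))"
    by (simp add: power2_eq_square power_numeral_reduce mult_ac)
  also have "\<dots> = ?l ^ 2 * (?l ^ (n - 2) * E * (?l\<^sup>2 * Q)\<^sup>2)"
    unfolding 1[symmetric] by (simp add: power2_eq_square power_numeral_reduce mult_ac)
  also have "\<dots> = ?l ^ 2 * (resultant_value n * asm_number (n - 1) ^ 4)"
    unfolding 2 by (simp add: resultant_value_def E_def)
  finally show ?thesis using refined_lead_nonzero[of n] n by simp
qed

text \<open>The resultant is A_{m+1}^(2m-2) / (-3)^(m(m+1)/2), multiplied out to avoid a negative
  exponent at m = 0. In each step the older count cancels completely, so no relation between
  successive A_n is needed.\<close>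

lemma resultant_value_eq:
  "resultant_value (m + 2) * (- 3) ^ (\<Sum>k\<le>m. k) * asm_number (m + 1) ^ 6 = asm_number (m + 1) ^ (2 * m + 4)"
proof (induction m)
  case 0
  then show ?case
    by (simp add: resultant_value_def refined_poly_Suc_0 asm_count_1)
next
  case (Suc m)
  let ?A = "asm_number (m + 2)" and ?B = "asm_number (m + 1)" and ?T = "\<Sum>k\<le>m. k"
  have step: "resultant_value (m + 3) * (- 3 * ?B\<^sup>2 / ?A\<^sup>2) ^ (m + 1) * ?A\<^sup>2 = resultant_value (m + 2) * ?B ^ 4"
    using resultant_value_step[of "m + 2"] by (simp add: numeral_3_eq_3)
  have "resultant_value (m + 3) * ((- 3) ^ (m + 1) * ?B ^ (2 * m + 2)) * ?A\<^sup>2 =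
     resultant_value (m + 2) * ?B ^ 4 * ?A ^ (2 * m + 2)"
  proof -
    have power: "(- 3 * ?B\<^sup>2 / ?A\<^sup>2) ^ (m + 1) * ?A ^ (2 * m + 2) = (- 3) ^ (m + 1) * ?B ^ (2 * m + 2)"
    proof -
      have e: "2 * m + 2 = 2 * (m + 1)" by simp
      show ?thesis
        unfolding e power_divide power_mult_distrib power_mult using asm_number_nonzero[of "m + 2"] by simp
    qed
    show ?thesis
      unfolding power[symmetric] step[symmetric] by (simp only: mult_ac)
  qed
  then have "(resultant_value (m + 3) * ((- 3) ^ (m + 1) * ?B ^ (2 * m + 2)) * ?A\<^sup>2) * ((- 3) ^ ?T * ?B\<^sup>2) =
     (resultant_value (m + 2) * ?B ^ 4 * ?A ^ (2 * m + 2)) * ((- 3) ^ ?T * ?B\<^sup>2)"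
    by simp
  also have "\<dots> = (resultant_value (m + 2) * (- 3) ^ ?T * ?B ^ 6) * ?A ^ (2 * m + 2)"
    by (simp add: power_numeral_reduce mult_ac)
  also have "\<dots> = ?B ^ (2 * m + 4) * ?A ^ (2 * m + 2)"
    unfolding Suc.IH ..
  finally have "?B ^ (2 * m + 4) * (resultant_value (m + 3) * ((- 3) ^ (m + 1) * (- 3) ^ ?T) * ?A\<^sup>2) =
     ?B ^ (2 * m + 4) * ?A ^ (2 * m + 2)"
    by (simp add: power_add power_numeral_reduce mult_ac)
  moreover have "?B ^ (2 * m + 4) \<noteq> 0" using asm_number_nonzero[of "m + 1"] by simp
  ultimately have "resultant_value (m + 3) * ((- 3) ^ (m + 1) * (- 3) ^ ?T) * ?A\<^sup>2 = ?A ^ (2 * m + 2)"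
    unfolding mult_cancel_left by blast
  moreover have p6: "?A ^ 6 = ?A\<^sup>2 * ?A ^ 4"
    by (simp flip: power_add)
  moreover have "2 * m + 6 = (2 * m + 2) + 4" by simp
  then have "?A ^ (2 * m + 6) = ?A ^ (2 * m + 2) * ?A ^ 4"
    by (simp only: power_add)
  ultimately have "resultant_value (m + 3) * ((- 3) ^ (m + 1) * (- 3) ^ ?T) * ?A ^ 6 = ?A ^ (2 * m + 6)"
    by (simp only: mult.assoc[symmetric])
  moreover have "(- 3 :: complex) ^ (\<Sum>k\<le>Suc m. k) = (- 3) ^ (m + 1) * (- 3) ^ ?T"
    by (simp add: power_add mult_ac)
  moreover have "Suc m + 2 = m + 3" "Suc m + 1 = m + 2" "2 * Suc m + 4 = 2 * m + 6" by simp_all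
  ultimately show ?case by (simp only:)
qed

text \<open>The Newton polynomials \<open>N j\<close> form the columns of an upper triangular
  \<open>?C\<close> that makes \<open>?V * ?C\<close> lower triangular; the powers of
  \<open>q\<close> on both diagonals agree and cancel.\<close>

lemma homogeneous_vandermonde:
  fixes p q :: "nat \<Rightarrow> complex"
  assumes q: "\<And>k. k < n \<Longrightarrow> q k \<noteq> 0"
  shows "det (mat n n (\<lambda>(k, i). p k ^ i * q k ^ (n - Suc i))) = (\<Prod>k<n. \<Prod>m<k. p k * q m - p m * q k)"
proof -
  define N where "N = (\<lambda>j. \<Prod>m<j. [:- p m, q m:])"
  have N_coeff: "(\<forall>i>j. coeff (N j) i = 0) \<and> coeff (N j) j = (\<Prod>m<j. q m)" for j
  proof (induction j)
    case 0
    then show ?case by (simp add: N_def)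
  next
    case (Suc j)
    have N_Suc: "N (Suc j) = smult (- p j) (N j) + pCons 0 (smult (q j) (N j))"
      by (simp add: N_def mult.commute)
    show ?case
      unfolding N_Suc using Suc by (auto simp: coeff_pCons split: nat.splits)
  qed
  have N_eval: "(\<Sum>i<n. p k ^ i * q k ^ (n - Suc i) * coeff (N j) i) =
      q k ^ (n - Suc j) * (\<Prod>m<j. p k * q m - p m * q k)" if "k < n" "j < n" for k j
  proof -
    have "degree (N j) < n"
      using N_coeff[of j] that(2) by (intro le_less_trans[OF degree_le]) auto
    then have "poly (N j) (p k / q k) = (\<Sum>i<n. coeff (N j) i * (p k / q k) ^ i)"
      unfolding poly_altdef by (intro sum.mono_neutral_left) (auto simp: coeff_eq_0)
    then have "(\<Sum>i<n. p k ^ i * q k ^ (n - Suc i) * coeff (N j) i) = q k ^ (n - 1) * poly (N j) (p k / q k)"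
    proof -
      have "q k ^ (n - 1) = q k ^ (n - Suc i) * q k ^ i" if "i < n" for i
        using that by (simp flip: power_add)
      then show ?thesis
        unfolding \<open>poly (N j) (p k / q k) = _\<close> sum_distrib_left
        using q[OF \<open>k < n\<close>] by (intro sum.cong refl) (simp add: field_simps)
    qed
    also have "poly (N j) (p k / q k) = (\<Prod>m<j. (p k * q m - p m * q k) / q k)"
      unfolding N_def poly_prod using q[OF that(1)] by (intro prod.cong refl) (simp add: field_simps)
    also have "\<dots> = (\<Prod>m<j. p k * q m - p m * q k) / q k ^ j"
      by (simp add: prod_dividef)
    also have "q k ^ (n - 1) = q k ^ (n - Suc j) * q k ^ j"
      using that by (simp flip: power_add)
    finally show ?thesis using q[OF that(1)] by simp
  qed
  let ?V = "mat n n (\<lambda>(k, i). p k ^ i * q k ^ (n - Suc i))" and ?C = "mat n n (\<lambda>(i, j). coeff (N j) i)"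
  have VC: "?V * ?C = mat n n (\<lambda>(k, j). q k ^ (n - Suc j) * (\<Prod>m<j. p k * q m - p m * q k))"
    by (rule eq_matI) (auto simp: scalar_prod_def atLeast0LessThan N_eval)
  have "det (?V * ?C) = (\<Prod>k<n. q k ^ (n - Suc k) * (\<Prod>m<k. p k * q m - p m * q k))"
    unfolding VC
    by (subst det_lower_triangular[of n]) (auto simp: prod_list_diag_prod atLeast0LessThan)
  moreover have "det ?C = (\<Prod>j<n. \<Prod>m<j. q m)"
    using N_coeff by (subst det_upper_triangular[of _ n]) (auto simp: prod_list_diag_prod atLeast0LessThan)
  moreover have "(\<Prod>j<n. \<Prod>m<j. q m) = (\<Prod>k<n. q k ^ (n - Suc k))"
  proof (induction n)
    case (Suc n)
    have "(\<Prod>k<n. q k ^ (Suc n - Suc k)) = (\<Prod>k<n. q k ^ (n - Suc k) * q k)"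
      by (intro prod.cong refl) (metis Suc_diff_Suc lessThan_iff diff_Suc_Suc power_Suc2)
    then show ?case by (simp add: Suc.IH prod.distrib)
  qed simp
  ultimately have "det ?V * (\<Prod>k<n. q k ^ (n - Suc k)) =
      (\<Prod>k<n. \<Prod>m<k. p k * q m - p m * q k) * (\<Prod>k<n. q k ^ (n - Suc k))"
    using det_mult[of ?V n ?C] by (simp add: prod.distrib mult.commute)
  then show ?thesis using q by simp
qed

lemma prod_off_diagonal:
  fixes f :: "nat \<Rightarrow> nat \<Rightarrow> complex"
  shows "(\<Prod>k<n. \<Prod>m\<in>{..<n} - {k}. f k m) = (\<Prod>k<n. \<Prod>m<k. f k m * f m k)"
proof (induction n)
  case (Suc n)
  have "{..<Suc n} - {n} = {..<n}" by auto
  moreover have "(\<Prod>m\<in>{..<Suc n} - {k}. f k m) = (\<Prod>m\<in>{..<n} - {k}. f k m) * f k n" if "k < n" for k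
  proof -
    have "{..<Suc n} - {k} = insert n ({..<n} - {k})" using that by auto
    then show ?thesis by (simp add: mult.commute)
  qed
  ultimately show ?case by (simp add: Suc.IH prod.distrib mult_ac)
qed simp

text \<open>This is 1/(\<omega> - \<omega>^2), the determinant of the change from x, 1 to the two
  weights up to sign.\<close>

definition weight_gap :: complex where "weight_gap = - (1 + 2 * \<omega>) / 3"

lemma weight_gap: "weight_a x 1 * weight_b y 1 - weight_a y 1 * weight_b x 1 = weight_gap * (x - y)"
  by (simp add: weight_a_def weight_b_def weight_gap_def field_simps omega_simps)

lemma weight_gap_sq: "weight_gap * weight_gap = - 1 / 3"
  by (simp add: weight_gap_def field_simps omega_simps)

lemma weight_a_eq_0: "weight_a x 1 = 0 \<Longrightarrow> x = \<omega>\<^sup>2"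
proof -
  assume "weight_a x 1 = 0"
  then have "(\<omega> - 1) * (x - \<omega>\<^sup>2) = 0"
    by (simp add: weight_a_def algebra_simps omega_simps)
  then show ?thesis using omega_neq_1 by simp
qed

lemma weight_b_eq_0: "weight_b x 1 = 0 \<Longrightarrow> x = \<omega>"
proof -
  assume "weight_b x 1 = 0"
  then have "(2 + \<omega>) * (x - \<omega>) = 0"
    by (simp add: weight_b_def algebra_simps omega_simps)
  moreover have "2 + \<omega> \<noteq> 0"
  proof
    assume "2 + \<omega> = 0"
    then have "\<omega> = - 2" by (simp add: eq_neg_iff_add_eq_0 add.commute)
    then have "\<omega> ^ 3 = (- 2) ^ 3" by (rule arg_cong)
    then have "(1 :: complex) = - 8" unfolding omega_cubed by simp
    then show False by simp
  qed
  ultimately show ?thesis by simp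
qed

text \<open>At x = y = r the Bezoutian formula reads 0 = 0, so x - r is cancelled as a polynomial
  before x = r is inserted. The product over the other zeros is the derivative of
  \<open>phi n\<close> at r up to the leading coefficient.\<close>

lemma doubly_refined_diagonal:
  assumes n: "n \<ge> 2" and r: "r \<in> insert 1 (refined_roots n)"
  shows "3 * asm_number (n - 1) * poly (doubly_refined_poly n r) r =
     refined_lead n * (\<Prod>q\<in>insert 1 (refined_roots n) - {r}. r - q) * psi n r"
proof -
  let ?Q = "insert 1 (refined_roots n)"
  have fin: "finite ?Q" using finite_refined_roots[of n] n by simp
  have n1: "1 \<notin> refined_roots n"
    using refined_poly_1[of n] asm_number_nonzero[of n] n by (simp add: refined_roots_def)
  have phi_eq: "phi n x = refined_lead n * (\<Prod>q\<in>?Q. x - q)" for x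
    using n1 finite_refined_roots[of n] n by (simp add: phi_def poly_refined_poly[OF n])
  have "phi n r = 0" using r fin by (auto simp: phi_eq)
  have "poly ([:- r, 1:] * smult (3 * asm_number (n - 1)) (doubly_refined_poly n r)) x =
      poly ([:- r, 1:] * smult (refined_lead n * psi n r) (\<Prod>q\<in>?Q - {r}. [:- q, 1:])) x" for x
  proof -
    have lin: "poly [:- q, 1:] x = x - q" for q :: complex by simp
    have "3 * asm_number (n - 1) * (x - r) * poly (doubly_refined_poly n r) x = phi n x * psi n r"
      using doubly_refined_bezoutian[OF n, of x r] \<open>phi n r = 0\<close> by simp
    also have "\<dots> = refined_lead n * ((x - r) * (\<Prod>q\<in>?Q - {r}. x - q)) * psi n r"
      unfolding phi_eq prod.remove[OF fin r] ..
    finally show ?thesis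
      unfolding poly_mult poly_smult poly_prod lin by (simp only: mult_ac)
  qed
  then have "[:- r, 1:] * smult (3 * asm_number (n - 1)) (doubly_refined_poly n r) =
      [:- r, 1:] * smult (refined_lead n * psi n r) (\<Prod>q\<in>?Q - {r}. [:- q, 1:])"
    by (intro poly_eq_poly_eq_iff[THEN iffD1] ext)
  then have "smult (3 * asm_number (n - 1)) (doubly_refined_poly n r) =
      smult (refined_lead n * psi n r) (\<Prod>q\<in>?Q - {r}. [:- q, 1:])"
    unfolding mult_cancel_left by simp
  then have "poly (smult (3 * asm_number (n - 1)) (doubly_refined_poly n r)) r =
      poly (smult (refined_lead n * psi n r) (\<Prod>q\<in>?Q - {r}. [:- q, 1:])) r" by simp
  then show ?thesis by (simp add: poly_prod mult_ac)
qed

definition complex_count_mat :: "nat \<Rightarrow> complex mat" where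
  "complex_count_mat n = mat n n (\<lambda>(i, j). of_nat (doubly_refined_count n i j))"

text \<open>Evaluating at the zeros of \<open>phi n\<close> on both sides gives
  \<open>?V * ?A * transpose_mat ?W\<close>, diagonal by the Bezoutian formula. The differences of
  zeros in the two Vandermonde determinants are those in the diagonal entries and cancel.\<close>

lemma det_complex_count_mat:
  assumes n: "n \<ge> 2"
  shows "det (complex_count_mat n) * (3 * asm_number (n - 1)) ^ n =
     (- 3) ^ (\<Sum>k<n. k) * (3 * asm_number (n - 1) ^ 3 * resultant_value n)"
proof -
  let ?Q = "insert 1 (refined_roots n)" and ?l = "refined_lead n"
  have fin: "finite ?Q" using finite_refined_roots[of n] n by simp
  have n1: "1 \<notin> refined_roots n"
    using refined_poly_1[of n] asm_number_nonzero[of n] n by (simp add: refined_roots_def)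
  have card: "card ?Q = n"
    using n1 finite_refined_roots[of n] card_refined_roots[OF n] n by simp
  obtain r where r: "bij_betw r {..<n} ?Q"
    using ex_bij_betw_nat_finite[OF fin] card by (auto simp: atLeast0LessThan)
  have r_in: "r k \<in> ?Q" if "k < n" for k
    using r that by (auto simp: bij_betw_def)
  have r_inj: "r k = r l \<longleftrightarrow> k = l" if "k < n" "l < n" for k l
    using r that by (auto simp: bij_betw_def inj_on_def)
  have phi_0: "phi n (r k) = 0" if "k < n" for k
    using r_in[OF that] by (auto simp: phi_def refined_roots_def)
  define a where "a = (\<lambda>k. weight_a (r k) 1)"
  define b where "b = (\<lambda>k. weight_b (r k) 1)"
  have "r k \<noteq> \<omega>" "r k \<noteq> \<omega>\<^sup>2" if "k < n" for k
  proof -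
    have "(r k)\<^sup>2 + r k + 1 \<noteq> 0"
      using r_in[OF that] refined_poly_root_neq(2)[of "n - 1" "r k"] n by (auto simp: refined_roots_def)
    then show "r k \<noteq> \<omega>" "r k \<noteq> \<omega>\<^sup>2" by (auto simp: quad1_factor)
  qed
  then have ab: "a k \<noteq> 0" "b k \<noteq> 0" if "k < n" for k
    using that weight_a_eq_0[of "r k"] weight_b_eq_0[of "r k"] by (auto simp: a_def b_def)
  let ?V = "mat n n (\<lambda>(k, i). a k ^ i * b k ^ (n - Suc i))"
  \<comment> \<open>The weights are swapped relative to \<open>?V\<close>, as they are in the last
    row.\<close>
  let ?W = "mat n n (\<lambda>(k, j). b k ^ j * a k ^ (n - Suc j))"
  let ?A = "complex_count_mat n"
  define P where "P = (\<lambda>k l. poly (doubly_refined_poly n (r l)) (r k))"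
  have carr: "?V \<in> carrier_mat n n" "?W \<in> carrier_mat n n" "?A \<in> carrier_mat n n"
    "transpose_mat ?W \<in> carrier_mat n n" "?V * ?A \<in> carrier_mat n n"
    unfolding complex_count_mat_def by (simp_all add: mult_carrier_mat[where n = n])
  have prod: "?V * ?A * transpose_mat ?W = mat n n (\<lambda>(k, l). P k l)"
  proof (rule eq_matI)
    fix k l assume "k < dim_row (mat n n (\<lambda>(k, l). P k l))" "l < dim_col (mat n n (\<lambda>(k, l). P k l))"
    then have kl: "k < n" "l < n" by simp_all
    have "(?V * ?A * transpose_mat ?W) $$ (k, l) =
      (\<Sum>j<n. (\<Sum>i<n. a k ^ i * b k ^ (n - Suc i) * of_nat (doubly_refined_count n i j)) *
         (b l ^ j * a l ^ (n - Suc j)))"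
      using kl by (simp add: scalar_prod_def complex_count_mat_def atLeast0LessThan)
    also have "\<dots> = P k l"
      unfolding P_def poly_doubly_refined_poly[OF n] a_def b_def
      by (subst sum.swap) (simp add: sum_distrib_left sum_distrib_right mult_ac)
    finally show "(?V * ?A * transpose_mat ?W) $$ (k, l) = mat n n (\<lambda>(k, l). P k l) $$ (k, l)"
      using kl by simp
  qed (simp_all add: complex_count_mat_def)
  have P_0: "P k l = 0" if "k < n" "l < n" "k \<noteq> l" for k l
  proof -
    have "3 * asm_number (n - 1) * (r k - r l) * P k l = 0"
      unfolding P_def doubly_refined_bezoutian[OF n] using phi_0 that by simp
    then show ?thesis using r_inj that asm_number_nonzero[of "n - 1"] by simp
  qed
  have P_diag: "3 * asm_number (n - 1) * P k k = ?l * (\<Prod>m\<in>{..<n} - {k}. r k - r m) * psi n (r k)" if "k < n" for k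
  proof -
    have "bij_betw r ({..<n} - {k}) (?Q - {r k})"
      using r that inj_on_image_set_diff[of r "{..<n}" "{..<n}" "{k}"]
      by (auto simp: bij_betw_def intro: inj_on_subset)
    then have "(\<Prod>m\<in>{..<n} - {k}. r k - r m) = (\<Prod>q\<in>?Q - {r k}. r k - q)"
      by (rule prod.reindex_bij_betw)
    then show ?thesis
      unfolding P_def by (simp only: doubly_refined_diagonal[OF n r_in[OF that]])
  qed
  have "det (mat n n (\<lambda>(k, l). P k l)) = (\<Prod>k<n. P k k)"
    using P_0 by (subst det_lower_triangular[of n]) (auto simp: prod_list_diag_prod atLeast0LessThan)
  then have vaw: "det ?V * det ?A * det ?W = (\<Prod>k<n. P k k)"
    using prod det_mult[OF carr(1,3)] det_mult[OF carr(5,4)] det_transpose[OF carr(2)] by simp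
  have dV: "det ?V = (\<Prod>k<n. \<Prod>m<k. weight_gap * (r k - r m))"
    using homogeneous_vandermonde[of n b a] ab by (simp add: a_def b_def weight_gap)
  have dW: "det ?W = (\<Prod>k<n. \<Prod>m<k. - (weight_gap * (r k - r m)))"
  proof -
    have "b k * a m - b m * a k = - (weight_gap * (r k - r m))" for k m
      unfolding weight_gap[symmetric] a_def b_def by simp
    then show ?thesis using homogeneous_vandermonde[of n a b] ab by simp
  qed
  have pairs: "(\<Prod>k<n. \<Prod>m<k. weight_gap * (r k - r m)) * (\<Prod>k<n. \<Prod>m<k. - (weight_gap * (r k - r m))) =
      (\<Prod>k<n. \<Prod>m<k. (- 1 / 3) * ((r k - r m) * (r m - r k)))"
  proof -
    have "(weight_gap * (r k - r m)) * - (weight_gap * (r k - r m)) = (- 1 / 3) * ((r k - r m) * (r m - r k))" for k m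
      unfolding weight_gap_sq[symmetric] by (simp add: algebra_simps)
    then show ?thesis
      by (simp only: prod.distrib[symmetric])
  qed
  have signs: "(\<Prod>k<n. \<Prod>m<k. (- 1 / 3) * ((r k - r m) * (r m - r k))) = (- 1 / 3) ^ (\<Sum>k<n. k) * (\<Prod>k<n. \<Prod>m\<in>{..<n} - {k}. r k - r m)"
  proof -
    have "(\<Prod>k<n. \<Prod>m<k. - 1 / 3 :: complex) = (- 1 / 3) ^ (\<Sum>k<n. k)"
      by (simp add: power_sum)
    then show ?thesis unfolding prod_off_diagonal prod.distrib by simp
  qed
  have D: "det ?A * ((- 1 / 3) ^ (\<Sum>k<n. k) * (\<Prod>k<n. \<Prod>m\<in>{..<n} - {k}. r k - r m)) = (\<Prod>k<n. P k k)"
    unfolding vaw[symmetric] dV dW signs[symmetric] pairs[symmetric] by (simp only: mult_ac)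
  let ?X = "\<Prod>k<n. \<Prod>m\<in>{..<n} - {k}. r k - r m"
  have "(3 * asm_number (n - 1)) ^ n * (\<Prod>k<n. P k k) = (\<Prod>k<n. 3 * asm_number (n - 1) * P k k)"
    by (simp add: prod.distrib)
  also have "\<dots> = (\<Prod>k<n. ?l * (\<Prod>m\<in>{..<n} - {k}. r k - r m) * psi n (r k))"
    using P_diag by (intro prod.cong refl) blast
  also have "\<dots> = ?l ^ n * ?X * (\<Prod>k<n. psi n (r k))"
    by (simp add: prod.distrib)
  also have "(\<Prod>k<n. psi n (r k)) = (\<Prod>q\<in>?Q. psi n q)"
    by (rule prod.reindex_bij_betw[OF r])
  finally have E: "(3 * asm_number (n - 1)) ^ n * (\<Prod>k<n. P k k) = ?X * (?l ^ n * (\<Prod>q\<in>?Q. psi n q))"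
    by (simp add: mult_ac)
  have "?l ^ n = ?l\<^sup>2 * ?l ^ (n - 2)" using n by (metis le_add_diff_inverse power_add)
  \<comment> \<open>The zero 1 contributes \<open>psi n 1\<close>, which is 3 A_{n-1}; the roots of
    S_n give the resultant.\<close>
  moreover have "(\<Prod>q\<in>?Q. psi n q) = 3 * asm_number (n - 1) * ((\<Prod>q\<in>refined_roots n. q\<^sup>2 + q + 1) *
      (\<Prod>q\<in>refined_roots n. poly (refined_poly (n - 1)) q))"
    using n1 finite_refined_roots[of n] n refined_poly_1[of "n - 1"] by (simp add: psi_def prod.distrib)
  ultimately have "?l ^ n * (\<Prod>q\<in>?Q. psi n q) = 3 * asm_number (n - 1) *
     ((?l\<^sup>2 * (\<Prod>q\<in>refined_roots n. q\<^sup>2 + q + 1)) * resultant_value n)"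
    by (simp add: resultant_value_def mult_ac)
  also have "\<dots> = 3 * asm_number (n - 1) ^ 3 * resultant_value n"
    unfolding prod_quad_refined_roots[OF n] by (simp add: power2_eq_square power3_eq_cube)
  finally have F: "?l ^ n * (\<Prod>q\<in>?Q. psi n q) = 3 * asm_number (n - 1) ^ 3 * resultant_value n" .
  have "?X \<noteq> 0" using r_inj by auto
  moreover have "?X * (det ?A * (3 * asm_number (n - 1)) ^ n * (- 1 / 3) ^ (\<Sum>k<n. k)) =
      ?X * (3 * asm_number (n - 1) ^ 3 * resultant_value n)"
    using E unfolding D[symmetric] F by (simp add: mult_ac)
  ultimately have "det ?A * (3 * asm_number (n - 1)) ^ n * (- 1 / 3) ^ (\<Sum>k<n. k) =
      3 * asm_number (n - 1) ^ 3 * resultant_value n" by simp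
  then have "(- 3) ^ (\<Sum>k<n. k) * (det ?A * (3 * asm_number (n - 1)) ^ n * (- 1 / 3) ^ (\<Sum>k<n. k)) =
      (- 3) ^ (\<Sum>k<n. k) * (3 * asm_number (n - 1) ^ 3 * resultant_value n)" by simp
  moreover have "(- 3) ^ (\<Sum>k<n. k) * (- 1 / 3) ^ (\<Sum>k<n. k) = (1 :: complex)"
    by (simp flip: power_mult_distrib)
  moreover have "(- 3) ^ (\<Sum>k<n. k) * (det ?A * (3 * asm_number (n - 1)) ^ n * (- 1 / 3) ^ (\<Sum>k<n. k)) =
     det ?A * (3 * asm_number (n - 1)) ^ n * ((- 3) ^ (\<Sum>k<n. k) * (- 1 / 3) ^ (\<Sum>k<n. k))"
    by (simp only: mult_ac)
  ultimately show ?thesis by simp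
qed

text \<open>One factor A_{m+1} stays on the left because the exponent m - 1 would be negative at m =
  0.\<close>

lemma det_complex_count_mat_eq:
  "det (complex_count_mat (m + 2)) * asm_number (m + 1) = (- 1) ^ (m + 1) * asm_number (m + 1) ^ m"
proof -
  let ?B = "asm_number (m + 1)" and ?D = "det (complex_count_mat (m + 2))" and ?R = "resultant_value (m + 2)"
  let ?T = "\<Sum>k\<le>m. k"
  have s: "(\<Sum>k<m + 2. k) = ?T + (m + 1)" by (simp add: lessThan_Suc_atMost)
  have det_eq: "?D * (3 * ?B) ^ (m + 2) = (- 3) ^ (?T + (m + 1)) * (3 * ?B ^ 3 * ?R)"
    using det_complex_count_mat[of "m + 2"] unfolding s by simp
  have "?D * (3 * ?B) ^ (m + 2) * ?B ^ 6 = (- 3) ^ (?T + (m + 1)) * (3 * ?B ^ 3 * ?R) * ?B ^ 6"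
    unfolding det_eq ..
  also have "\<dots> = (- 3) ^ (m + 1) * 3 * ?B ^ 3 * (?R * (- 3) ^ ?T * ?B ^ 6)"
    by (simp only: power_add mult_ac)
  also have "\<dots> = (- 3) ^ (m + 1) * 3 * ?B ^ 3 * ?B ^ (2 * m + 4)"
    unfolding resultant_value_eq ..
  finally have total: "?D * (3 * ?B) ^ (m + 2) * ?B ^ 6 = (- 3) ^ (m + 1) * 3 * ?B ^ 3 * ?B ^ (2 * m + 4)" .
  \<comment> \<open>After the resultant absorbs most powers of -3, the remainder matches 3^n from
    the normalisation of the Bezoutian up to this sign.\<close>
  have sign: "(- 3 :: complex) ^ (m + 1) * 3 = (- 1) ^ (m + 1) * 3 ^ (m + 2)"
    by (simp add: power_minus[of 3])
  have B_pow: "?B ^ 3 * ?B ^ (2 * m + 4) = ?B ^ (m + 7) * ?B ^ m" "?B ^ (m + 7) * ?B = ?B ^ (m + 2) * ?B ^ 6"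
    by (simp_all flip: power_add power_Suc2 add: eval_nat_numeral)
  have "3 ^ (m + 2) * ?B ^ (m + 7) * (?D * ?B) = 3 ^ (m + 2) * ?D * (?B ^ (m + 7) * ?B)"
    by (simp only: mult_ac)
  also have "\<dots> = ?D * (3 * ?B) ^ (m + 2) * ?B ^ 6"
    unfolding B_pow power_mult_distrib by (simp only: mult_ac)
  also have "\<dots> = ((- 3) ^ (m + 1) * 3) * (?B ^ 3 * ?B ^ (2 * m + 4))"
    unfolding total by (simp only: mult.assoc)
  also have "\<dots> = 3 ^ (m + 2) * ?B ^ (m + 7) * ((- 1) ^ (m + 1) * ?B ^ m)"
    unfolding sign B_pow by (simp only: mult_ac)
  finally have "3 ^ (m + 2) * ?B ^ (m + 7) * (?D * ?B) = 3 ^ (m + 2) * ?B ^ (m + 7) * ((- 1) ^ (m + 1) * ?B ^ m)" .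
  moreover have "3 ^ (m + 2) * ?B ^ (m + 7) \<noteq> 0" using asm_number_nonzero[of "m + 1"] by simp
  ultimately show ?thesis unfolding mult_cancel_left by blast
qed

lemma det_doubly_refined_mat_1: "det (doubly_refined_mat 1) = 1"
proof -
  have "M = 1\<^sub>m 1" if "M \<in> ASM 1" for M
  proof (rule eq_matI)
    fix i j assume "i < dim_row (1\<^sub>m 1)" "j < dim_col (1\<^sub>m 1)"
    moreover have "(\<Sum>j<1. row M 0 $ j) = 1"
      using that by (auto simp: ASM_def asm_line_def)
    moreover have "dim_row M = 1" "dim_col M = 1" using that by (auto simp: ASM_def)
    ultimately show "M $$ (i, j) = 1\<^sub>m 1 $$ (i, j)" by simp
  qed (use that in \<open>auto simp: ASM_def\<close>)
  moreover have "ASM 1 \<noteq> {}"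
    using asm_count_pos[of 1] by (auto simp: asm_count_def)
  ultimately have "ASM 1 = {1\<^sub>m 1}" by auto
  then have "{M \<in> ASM 1. M $$ (0, 0) = 1 \<and> M $$ (1 - 1, 0) = 1} = {1\<^sub>m 1}" by auto
  then have "doubly_refined_count 1 0 0 = 1"
    unfolding doubly_refined_count_def by simp
  then show ?thesis
    by (subst det_single) (simp_all add: doubly_refined_mat_def)
qed

theorem theorem1:
  fixes n :: nat
  assumes "n \<ge> 1"
  shows "det (doubly_refined_mat n) = (- (of_nat (asm_count (n - 1)) :: rat)) powi (int n - 3)"
proof (cases "n = 1")
  case True
  then show ?thesis using det_doubly_refined_mat_1 by (simp add: asm_count_0)
next
  case False
  define m where "m = n - 2"
  have n: "n = m + 2" using False assms by (simp add: m_def)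
  let ?B = "of_nat (asm_count (m + 1)) :: rat"
  have "complex_count_mat n = map_mat of_rat (doubly_refined_mat n)"
    by (rule eq_matI) (auto simp: complex_count_mat_def doubly_refined_mat_def)
  \<comment> \<open>The cube root of unity has disappeared from the identity, so it descends to the
    rationals by injectivity of \<open>of_rat\<close>.\<close>
  then have "of_rat (det (doubly_refined_mat n) * ?B) = (of_rat ((- 1) ^ (m + 1) * ?B ^ m) :: complex)"
    using det_complex_count_mat_eq[of m] of_rat_hom.hom_det[of "doubly_refined_mat n"]
    by (simp add: n of_rat_mult of_rat_power of_rat_minus)
  then have eq: "det (doubly_refined_mat n) * ?B = (- 1) ^ (m + 1) * ?B ^ m"
    unfolding of_rat_eq_iff .
  have B: "?B \<noteq> 0" using asm_count_pos[of "m + 1"] by simp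
  have "(- ?B) powi (int n - 3) = (- ?B) powi (int m - 1)" by (simp add: n)
  also have "\<dots> = (- ?B) ^ m / (- ?B)"
    using B by (simp add: power_int_diff)
  also have "\<dots> = det (doubly_refined_mat n)"
    unfolding power_minus[of ?B m] using eq B by (simp add: field_simps)
  finally show ?thesis by (simp add: n)
qed

end
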